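(* Let $d\ge1$ be fixed (not changing with $n$). For each $n$ let $\mathbf{X}_0=[\mathbf{x}_{01},\ldots,\mathbf{x}_{0n}]^{\mathrm T}\in\mathbb{R}^{n\times d}$ have rows in $\mathcal{X}$, and let $\mathbf{Y}\sim\mathrm{RDPG}(\mathbf{X}_0)$. Let the prior $\Pi$ on $\mathbf{X}=[\mathbf{x}_1,\ldots,\mathbf{x}_n]^{\mathrm T}\in\mathcal{X}^n$ make $\mathbf{x}_1,\ldots,\mathbf{x}_n$ independent, each with density $\pi_{\mathbf{x}}$ supported on $\mathcal{X}$ and bounded away from $0$ and $\infty$ over $\mathcal{X}$. Assume $\frac1n\mathbf{X}_0^{\mathrm T}\mathbf{X}_0\to\mathbf{\Delta}$ as $n\to\infty$ for some positive definite $\mathbf{\Delta}\in\mathbb{R}^{d\times d}$, and $\delta\le\min_{i,j}\mathbf{x}_{0i}^{\mathrm T}\mathbf{x}_{0j}\le\max_{i,j}\mathbf{x}_{0i}^{\mathrm T}\mathbf{x}_{0j}\le 1-\delta$ for some constant $\delta\in(0,1/2)$ independent of $n$. Let $M_1>0$ be a constant such that, for all sufficiently large $n$, $$\mathbb{E}_0\left\{\Pi\left(\tfrac1n\|\mathbf{X}\mathbf{X}^{\mathrm T}-\mathbf{X}_0\mathbf{X}_0^{\mathrm T}\|_{\mathrm F}>\tfrac{M_1}{\sqrt n}\ \Big|\ \mathbf{Y}\right)\right\}\le 8\exp\left(-\tfrac12 nd\right)$$ (such a constant, depending on $\mathbf{\Delta}$ and $\pi_{\mathbf{x}}$, exists when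 $d$ is fixed, $\mathbf{Y}\sim\mathrm{RDPG}(\mathbf{X}_0)$ with the rows of $\mathbf{X}_0$ in $\mathcal{X}$, the rows of $\mathbf{X}$ are independent under $\Pi$ with density $\pi_{\mathbf{x}}$ supported on $\mathcal{X}$ and bounded away from $0$ and $\infty$ over $\mathcal{X}$, $\frac1n\mathbf{X}_0^{\mathrm T}\mathbf{X}_0\to\mathbf{\Delta}$ with $\mathbf{\Delta}$ positive definite, and $\delta\le\mathbf{x}_{0i}^{\mathrm T}\mathbf{x}_{0j}\le1-\delta$ for all $i,j$ with $\delta\in(0,1/2)$ independent of $n$). Consider the posterior mean of the edge probability matrix $$\widetilde{\mathbf{P}}=\int_{\mathcal{X}^n}\mathbf{X}\mathbf{X}^{\mathrm T}\,\Pi(\mathrm{d}\mathbf{X}\mid\mathbf{Y}),$$ with spectral decomposition $\widetilde{\mathbf{P}}=\sum_{j=1}^n\widehat\lambda_j\widehat{\mathbf{u}}_j\widehat{\mathbf{u}}_j^{\mathrm T}$, where $\widehat\lambda_1\ge\cdots\ge\widehat\lambda_n$ are the eigenvalues of $\widetilde{\mathbf{P}}$ and $\widehat{\mathbf{u}}_1,\ldots,\widehat{\mathbf{u}}_n$ are associated orthonormal eigenvectors. Let $\widehat{\mathbf{U}}=[\widehat{\mathbf{u}}_1,\ldots,\widehat{\mathbf{u}}_d]$, $\widehat{\mathbf{S}}=\mathrm{diag}(\widehat\lambda_1,\ldots,\widehat\lambda_d)$, $\widehat{\mathbf{X}}=\widehat{\mathbf{U}}\widehat{\mathbf{S}}^{1/2}$,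 and let $\mathbf{U}_0$ be the left-singular vector matrix of $\mathbf{X}_0$. Then there is a constant $C>0$ independent of $n$ such that for all sufficiently large $n$, $$\mathbb{E}_0\left\{\frac1n\inf_{\mathbf{W}\in\mathbb{O}(d)}\|\widehat{\mathbf{X}}-\mathbf{X}_0\mathbf{W}\|_{\mathrm F}^2\right\}\le\frac{C}{n}.$$ Furthermore, for all sufficiently large $n$, $$\mathbb{P}_0\left(\inf_{\mathbf{W}\in\mathbb{O}(d)}\|\widehat{\mathbf{U}}-\mathbf{U}_0\mathbf{W}\|_{\mathrm F}^2>\frac{128M_1^2d}{\lambda_d^2(\mathbf{\Delta})\,n}\right)\le 2\exp\left(-\tfrac14M_1d\sqrt n\right).$$
   Context: $\mathcal{X}=\{\mathbf{x}\in\mathbb{R}^d:\|\mathbf{x}\|_2\le 1,\ \mathbf{x}\ge 0\}$ (entrywise), and $\mathcal{X}^n$ is the set of $n\times d$ matrices with all rows in $\mathcal{X}$. A symmetric random matrix $\mathbf{Y}=[y_{ij}]\in\{0,1\}^{n\times n}$ satisfies $\mathbf{Y}\sim\mathrm{RDPG}(\mathbf{X})$ if $y_{ij}\sim\mathrm{Bernoulli}(\mathbf{x}_i^{\mathrm T}\mathbf{x}_j)$ independently for $1\le i\le j\le n$. The posterior distribution is, for measurable $\mathcal{A}\subset\mathcal{X}^n$, $$\Pi(\mathbf{X}\in\mathcal{A}\mid\mathbf{Y})=\frac{N_n(\mathcal{A})}{D_n},\quad N_n(\mathcal{A})=\int_{\mathcal{A}}\prod_{i\le j}\frac{p(y_{ij}\mid\mathbf{X})}{p(y_{ij}\mid\mathbf{X}_0)}\,\Pi(\mathrm{d}\mathbf{X}),\quad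 D_n=N_n(\mathcal{X}^n),$$ where $p(y_{ij}\mid\mathbf{X})=(\mathbf{x}_i^{\mathrm T}\mathbf{x}_j)^{y_{ij}}(1-\mathbf{x}_i^{\mathrm T}\mathbf{x}_j)^{1-y_{ij}}$. $\mathbb{P}_0,\mathbb{E}_0$ are probability and expectation with respect to $\mathbf{Y}\sim\mathrm{RDPG}(\mathbf{X}_0)$. $\mathbb{O}(d)$ is the set of $d\times d$ orthogonal matrices. $\lambda_k(\mathbf{\Delta})$ is the $k$th largest eigenvalue of $\mathbf{\Delta}$, so $\lambda_d(\mathbf{\Delta})$ is the smallest. The left-singular vector matrix of $\mathbf{X}_0$ is the $n\times d$ matrix $\mathbf{U}_0$ with orthonormal columns in the singular value decomposition $\mathbf{X}_0=\mathbf{U}_0\mathbf{S}_0^{1/2}\mathbf{V}_0^{\mathrm T}$ with $\mathbf{V}_0\in\mathbb{O}(d)$ and $\mathbf{S}_0^{1/2}$ diagonal with non-negative entries. *)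

theory Defs
  imports "HOL-Probability.Probability"
begin

text \<open>
  The fixed dimension d is CARD('d).  An n x d matrix is given by its rows, as a function of type
  nat => real^'d restricted to {..<n}, and an n x n matrix is a function nat => nat => real
  restricted to {..<n} x {..<n}; row and column indices start at 0.
\<close>

subsection \<open>Matrices\<close>

definition frobenius_norm :: "'a set \<Rightarrow> 'b set \<Rightarrow> ('a \<Rightarrow> 'b \<Rightarrow> real) \<Rightarrow> real" where
  "frobenius_norm I J A = sqrt (\<Sum>i\<in>I. \<Sum>j\<in>J. (A i j)\<^sup>2)"

definition edge_prob :: "(nat \<Rightarrow> real^'d) \<Rightarrow> nat \<Rightarrow> nat \<Rightarrow> real" where
  "edge_prob X i j = X i \<bullet> X j"

definition gram_matrix :: "nat \<Rightarrow> (nat \<Rightarrow> real^'d) \<Rightarrow> real^'d^'d" where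
  "gram_matrix n X = (\<chi> k l. \<Sum>i<n. X i $ k * X i $ l)"

definition positive_definite :: "real^'d^'d \<Rightarrow> bool" where
  "positive_definite A \<longleftrightarrow> transpose A = A \<and> (\<forall>v. v \<noteq> 0 \<longrightarrow> 0 < v \<bullet> (A *v v))"

definition eigenvalues :: "real^'d^'d \<Rightarrow> real set" where
  "eigenvalues A = {l. \<exists>v. v \<noteq> 0 \<and> A *v v = l *\<^sub>R v}"

definition smallest_eigenvalue :: "real^'d^'d \<Rightarrow> real" where
  "smallest_eigenvalue A = Min (eigenvalues A)"

text \<open>
  X = U diag(s) V^T with U having orthonormal columns.  Such a U exists only if n is at least d.
\<close>

definition left_singular_vectors :: "nat \<Rightarrow> (nat \<Rightarrow> real^'d) \<Rightarrow> (nat \<Rightarrow> real^'d) \<Rightarrow> bool" where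
  "left_singular_vectors n X U \<longleftrightarrow>
     gram_matrix n U = mat 1 \<and>
     (\<exists>(s :: real^'d) (V :: real^'d^'d).
        orthogonal_matrix V \<and> (\<forall>k. 0 \<le> s $ k) \<and>
        (\<forall>i<n. \<forall>k. X i $ k = (\<Sum>l\<in>UNIV. U i $ l * s $ l * V $ k $ l)))"

text \<open>
  The k-th eigenvalue is lam k and u k i is the i-th entry of the k-th eigenvector.
\<close>

definition spectral_decomposition ::
    "nat \<Rightarrow> (nat \<Rightarrow> nat \<Rightarrow> real) \<Rightarrow> (nat \<Rightarrow> real) \<Rightarrow> (nat \<Rightarrow> nat \<Rightarrow> real) \<Rightarrow> bool" where
  "spectral_decomposition n P lam u \<longleftrightarrow>
     (\<forall>j k. j \<le> k \<and> k < n \<longrightarrow> lam k \<le> lam j) \<and>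
     (\<forall>j<n. \<forall>k<n. (\<Sum>i<n. u j i * u k i) = (if j = k then 1 else 0)) \<and>
     (\<forall>i<n. \<forall>j<n. P i j = (\<Sum>k<n. lam k * u k i * u k j))"

text \<open>
  The columns are indexed by the type 'd; the bijection e from 'd onto {..<d} says which of the
  d leading eigenpairs is put in which column.
\<close>

definition leading_eigenvectors ::
    "('d \<Rightarrow> nat) \<Rightarrow> (nat \<Rightarrow> nat \<Rightarrow> real) \<Rightarrow> nat \<Rightarrow> real^'d" where
  "leading_eigenvectors e u i = (\<chi> k. u (e k) i)"

definition spectral_embedding ::
    "('d \<Rightarrow> nat) \<Rightarrow> (nat \<Rightarrow> real) \<Rightarrow> (nat \<Rightarrow> nat \<Rightarrow> real) \<Rightarrow> nat \<Rightarrow> real^'d" where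
  "spectral_embedding e lam u i = (\<chi> k. u (e k) i * sqrt (lam (e k)))"

definition procrustes_sq :: "nat \<Rightarrow> (nat \<Rightarrow> real^'d) \<Rightarrow> (nat \<Rightarrow> real^'d) \<Rightarrow> real" where
  "procrustes_sq n A B =
     (INF W\<in>{W :: real^'d^'d. orthogonal_matrix W}.
        (frobenius_norm {..<n} UNIV (\<lambda>i k. A i $ k - (B i v* W) $ k))\<^sup>2)"

subsection \<open>The random dot product graph model\<close>

definition latent_space :: "(real^'d) set" where
  "latent_space = {x. norm x \<le> 1 \<and> (\<forall>k. 0 \<le> x $ k)}"

definition latent_matrices :: "nat \<Rightarrow> (nat \<Rightarrow> real^'d) set" where
  "latent_matrices n = (\<Pi>\<^sub>E i\<in>{..<n}. latent_space)"

text \<open>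
  The law of the adjacency matrix: the entries with i \<le> j < n are independent Bernoulli variables,
  the matrix is symmetric, and entries outside {..<n} x {..<n} are 0.
\<close>

definition rdpg :: "nat \<Rightarrow> (nat \<Rightarrow> real^'d) \<Rightarrow> (nat \<Rightarrow> nat \<Rightarrow> nat) pmf" where
  "rdpg n X =
     map_pmf (\<lambda>z i j. of_bool (z (min i j, max i j)))
       (Pi_pmf {(i, j). i \<le> j \<and> j < n} False (\<lambda>(i, j). bernoulli_pmf (edge_prob X i j)))"

definition edge_lik :: "(nat \<Rightarrow> real^'d) \<Rightarrow> (nat \<Rightarrow> nat \<Rightarrow> nat) \<Rightarrow> nat \<Rightarrow> nat \<Rightarrow> real" where
  "edge_lik X Y i j = edge_prob X i j ^ Y i j * (1 - edge_prob X i j) ^ (1 - Y i j)"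

definition lik_ratio ::
    "nat \<Rightarrow> (nat \<Rightarrow> real^'d) \<Rightarrow> (nat \<Rightarrow> nat \<Rightarrow> nat) \<Rightarrow> (nat \<Rightarrow> real^'d) \<Rightarrow> real" where
  "lik_ratio n X0 Y X =
     (\<Prod>(i, j)\<in>{(i, j). i \<le> j \<and> j < n}. edge_lik X Y i j / edge_lik X0 Y i j)"

definition prior :: "nat \<Rightarrow> (real^'d \<Rightarrow> real) \<Rightarrow> (nat \<Rightarrow> real^'d) measure" where
  "prior n \<pi> = (\<Pi>\<^sub>M i\<in>{..<n}. density lborel (\<lambda>x. ennreal (\<pi> x)))"

definition evidence ::
    "nat \<Rightarrow> (nat \<Rightarrow> real^'d) \<Rightarrow> (real^'d \<Rightarrow> real) \<Rightarrow> (nat \<Rightarrow> nat \<Rightarrow> nat) \<Rightarrow>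
     (nat \<Rightarrow> real^'d) set \<Rightarrow> ennreal" where
  "evidence n X0 \<pi> Y A = (\<integral>\<^sup>+ X \<in> A. ennreal (lik_ratio n X0 Y X) \<partial>prior n \<pi>)"

definition posterior ::
    "nat \<Rightarrow> (nat \<Rightarrow> real^'d) \<Rightarrow> (real^'d \<Rightarrow> real) \<Rightarrow> (nat \<Rightarrow> nat \<Rightarrow> nat) \<Rightarrow>
     (nat \<Rightarrow> real^'d) measure" where
  "posterior n X0 \<pi> Y =
     density (prior n \<pi>)
       (\<lambda>X. ennreal (lik_ratio n X0 Y X) * indicator (latent_matrices n) X
              / evidence n X0 \<pi> Y (latent_matrices n))"

definition posterior_mean ::
    "nat \<Rightarrow> (nat \<Rightarrow> real^'d) \<Rightarrow> (real^'d \<Rightarrow> real) \<Rightarrow> (nat \<Rightarrow> nat \<Rightarrow> nat) \<Rightarrow>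
     nat \<Rightarrow> nat \<Rightarrow> real" where
  "posterior_mean n X0 \<pi> Y i j = (\<integral>X. edge_prob X i j \<partial>posterior n X0 \<pi> Y)"

lemma sets_prior: "sets (prior n \<pi>) = sets (\<Pi>\<^sub>M i\<in>{..<n}. borel)"
  unfolding prior_def by (intro sets_PiM_cong) auto

lemma measurable_lik_ratio [measurable]: "lik_ratio n X0 Y \<in> borel_measurable (prior n \<pi>)"
proof -
  have *: "finite {(i, j). i \<le> j \<and> j < n}"
    by (rule finite_subset[of _ "{..<n} \<times> {..<n}"]) auto
  have 1: "(\<lambda>X. X i \<bullet> X j) \<in> borel_measurable (\<Pi>\<^sub>M i\<in>{..<n}. borel :: (real^'a) measure)"
    if "i < n" "j < n" for i j
    using that by (intro borel_measurable_inner measurable_component_singleton) auto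
  have "lik_ratio n X0 Y \<in> borel_measurable (\<Pi>\<^sub>M i\<in>{..<n}. borel)"
    unfolding lik_ratio_def edge_lik_def edge_prob_def
    by (rule borel_measurable_prod)
       (auto intro!: borel_measurable_divide borel_measurable_times borel_measurable_power
          borel_measurable_diff 1)
  thus ?thesis
    by (simp add: measurable_cong_sets[OF sets_prior refl])
qed

lemma sets_latent_matrices [measurable]: "latent_matrices n \<in> sets (prior n \<pi>)"
proof -
  have "closed (latent_space :: (real^'a) set)"
    unfolding latent_space_def
    by (intro closed_Collect_conj closed_Collect_all closed_Collect_le continuous_intros)
  thus ?thesis
    unfolding latent_matrices_def sets_prior by (intro sets_PiM_I_finite) auto
qed

text \<open>
  The posterior measure has the defining property that the probability of A is N(A) / D.
\<close>

lemma emeasure_posterior: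
  assumes "A \<in> sets (prior n \<pi>)" "A \<subseteq> latent_matrices n"
  shows "emeasure (posterior n X0 \<pi> Y) A =
           evidence n X0 \<pi> Y A / evidence n X0 \<pi> Y (latent_matrices n)"
proof -
  have [measurable]: "A \<in> sets (prior n \<pi>)" by fact
  have "emeasure (posterior n X0 \<pi> Y) A =
          (\<integral>\<^sup>+X. ennreal (lik_ratio n X0 Y X) * indicator (latent_matrices n) X
              / evidence n X0 \<pi> Y (latent_matrices n) * indicator A X \<partial>prior n \<pi>)"
    unfolding posterior_def by (subst emeasure_density) auto
  also have "\<dots> = (\<integral>\<^sup>+X. ennreal (lik_ratio n X0 Y X) * indicator A X
              / evidence n X0 \<pi> Y (latent_matrices n) \<partial>prior n \<pi>)"
    using assms(2) by (intro nn_integral_cong) (auto simp: indicator_def)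
  also have "\<dots> = evidence n X0 \<pi> Y A / evidence n X0 \<pi> Y (latent_matrices n)"
    unfolding evidence_def by (subst nn_integral_divide) auto
  finally show ?thesis .
qed

end

theory Submission
  imports Defs "HOL-Real_Asymp.Real_Asymp"
begin

text \<open>
  The posterior mean of the edge probability matrix is close to the truth in Frobenius norm, and the
  rest is perturbation theory for matrices of rank d whose nonzero eigenvalues grow linearly in n.

  Let E be the difference of the posterior mean and the true matrix P0 = X0 X0^T, and let p be the
  posterior mass of the matrices X with the Frobenius distance of X X^T and P0 above M1 times the root
  of n.  Entries are probabilities, so that distance is never above n, and Jensen's inequality gives
  |E|^2 \<le> M1^2 n + n^2 p (posterior_mean_error).  The contraction hypothesis makes the expectation of p
  exponentially small.  Hence |E|^2 has expectation of order n, and Markov's inequality shows that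
  |E|^2 \<le> 4 M1^2 n outside of an exponentially unlikely event.

  The convergence of X0^T X0 / n to \<open>\<Delta>\<close> bounds the nonzero eigenvalues of P0 below by
  \<open>\<sigma>\<close> = c n for every c below the least eigenvalue of \<open>\<Delta>\<close>
  (gram_limit_lower_bound).  Three deterministic facts turn the bound on E into the two claims.
  The truncated spectral decomposition of the posterior mean is within 2 |E| of P0, by the
  Eckart--Young theorem (eckart_young_tail).  The Procrustes distance of two factors is controlled by
  the distance of their Gram matrices (procrustes_sq_le): the best rotation makes the
  cross Gram matrix symmetric and positive semidefinite, and then the difference of the Gram matrices can
  be expanded and bounded below by completing a square.  Applied to the embedding and X0 this gives
  a squared distance of at most 5 |E|^2 / \<open>\<sigma>\<close>, which is bounded in expectation.  Finally, the
  projections onto the leading eigenvectors and onto the range of X0 differ by a multiple of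
  |E| / \<open>\<sigma>\<close> (sin_theta_bound), and the Procrustes bound, applied to these projections, gives
  10 |E|^2 / \<open>\<sigma>\<close>^2 for the eigenvectors.
\<close>

section \<open>Polar decomposition\<close>

definition outer :: "real^'d \<Rightarrow> real^'d \<Rightarrow> real^'d^'d" where
  "outer v w = (\<chi> i j. v $ i * w $ j)"

lemma matrix_mult_outer: "C ** outer v w = outer (C *v v) w"
  by (simp add: outer_def vec_eq_iff matrix_matrix_mult_def matrix_vector_mult_def
      sum_distrib_right mult.assoc)

lemma trace_outer: "trace (outer v w) = v \<bullet> w"
  by (simp add: outer_def trace_def inner_vec_def)

lemma outer_mult_vec: "outer v w *v x = (w \<bullet> x) *\<^sub>R v"
  by (simp add: outer_def vec_eq_iff matrix_vector_mult_def inner_vec_def sum_distrib_left mult_ac)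

definition householder :: "real^'d \<Rightarrow> real^'d^'d" where
  "householder v = mat 1 - (2 / (v \<bullet> v)) *\<^sub>R outer v v"

lemma outer_scaleR_left: "outer (c *\<^sub>R v) w = c *\<^sub>R outer v w"
  by (simp add: outer_def vec_eq_iff)

lemma matrix_diff_ldistrib: "A ** (B - C) = A ** B - A ** (C :: real^'n^'m)"
  by (simp add: vec_eq_iff matrix_matrix_mult_def algebra_simps sum_subtractf)

lemma mult_householder:
  "C ** householder v = C - (2 / (v \<bullet> v)) *\<^sub>R outer (C *v v) v"
  by (simp add: householder_def matrix_diff_ldistrib matrix_scalar_ac matrix_mult_outer
      scaleR_matrix_vector_assoc [symmetric] outer_scaleR_left)

lemma orthogonal_householder:
  assumes "v \<noteq> 0" shows "orthogonal_matrix (householder v)"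
proof -
  have "transpose (householder v) = householder v"
    by (simp add: householder_def vec_eq_iff transpose_def outer_def mat_def mult.commute)
  moreover have "householder v *v v = - v"
    using assms by (simp add: householder_def matrix_vector_mult_diff_rdistrib outer_mult_vec
        scaleR_matrix_vector_assoc [symmetric] scaleR_2)
  moreover have "outer (- v) v = - outer v v"
    by (simp add: outer_def vec_eq_iff)
  ultimately show ?thesis
    unfolding orthogonal_matrix by (simp add: mult_householder) (simp add: householder_def)
qed

lemma trace_scaleR: "trace (c *\<^sub>R A) = c * trace (A :: real^'n^'n)"
  by (simp add: trace_def sum_distrib_left)

lemma trace_mult_householder:
  "trace (C ** householder v) = trace C - 2 * (v \<bullet> (C *v v)) / (v \<bullet> v)"
  by (simp add: mult_householder trace_sub trace_scaleR trace_outer inner_commute)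

lemma mult_householder_vec:
  fixes C :: "real^'d^'d"
  shows "(C ** householder v) *v w = C *v w - (2 * (v \<bullet> w) / (v \<bullet> v)) *\<^sub>R (C *v v)"
  unfolding mult_householder
  by (simp add: matrix_vector_mult_diff_rdistrib outer_mult_vec
      scaleR_matrix_vector_assoc [symmetric])

text \<open>
  If the identity maximises the trace of C Q over orthogonal Q, then replacing it by the Householder
  reflection along v must not raise the trace, and that change is a negative multiple of the quadratic
  form of C at v.
\<close>

lemma trace_max_imp_psd:
  fixes C :: "real^'d^'d"
  assumes max: "\<And>Q. orthogonal_matrix Q \<Longrightarrow> trace (C ** Q) \<le> trace C"
  shows "0 \<le> v \<bullet> (C *v v)"
proof (cases "v = 0")
  case False
  then have "0 \<le> 2 * (v \<bullet> (C *v v)) / (v \<bullet> v)"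
    using max[OF orthogonal_householder[OF False]] by (simp add: trace_mult_householder)
  then show ?thesis using False
    by (simp add: zero_le_divide_iff zero_le_mult_iff) (metis inner_eq_zero_iff inner_ge_zero order_antisym)
qed auto

lemma quadratic_nonpos_imp_linear_coeff_zero:
  fixes a b :: real
  assumes "\<And>t. t * b \<le> t\<^sup>2 * a"
  shows "b = 0"
proof (rule ccontr)
  assume "b \<noteq> 0"
  define s where "s = \<bar>a\<bar> + 1"
  have s: "0 < s" by (simp add: s_def add_nonneg_pos)
  have "b\<^sup>2 * s = s\<^sup>2 * (b / s * b)" using s by (simp add: field_simps power2_eq_square)
  also have "\<dots> \<le> s\<^sup>2 * ((b / s)\<^sup>2 * a)" by (intro mult_left_mono assms) simp
  also have "\<dots> = b\<^sup>2 * a" using s by (simp add: field_simps power2_eq_square)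
  finally show False using \<open>b \<noteq> 0\<close> by (simp add: s_def)
qed

text \<open>
  Two reflections compose to a rotation of the plane spanned by two coordinate axes.  To first order
  in the angle, such a rotation changes the trace by a multiple of C k l - C l k, which has to vanish
  at a maximum.  Reflecting in x and then in x + t y gives this rotation rationally in t, so the
  condition is one about a quadratic polynomial.
\<close>

lemma trace_max_imp_symmetric:
  fixes C :: "real^'d^'d"
  assumes max: "\<And>Q. orthogonal_matrix Q \<Longrightarrow> trace (C ** Q) \<le> trace C"
  shows "transpose C = C"
proof -
  have "C $ k $ l = C $ l $ k" if "k \<noteq> l" for k l
  proof -
    define x y :: "real^'d" where "x = axis k 1" and "y = axis l 1"
    have xy: "x \<bullet> x = 1" "y \<bullet> y = 1" "x \<bullet> y = 0" "y \<bullet> x = 0"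
      using that by (simp_all add: x_def y_def inner_axis_axis)
    have Cxy: "y \<bullet> (C *v x) = C $ l $ k" "x \<bullet> (C *v y) = C $ k $ l"
      by (simp_all add: x_def y_def inner_axis' matrix_vector_mul_component inner_axis)
    have "t * (C $ l $ k - C $ k $ l) \<le> t\<^sup>2 * (x \<bullet> (C *v x) + y \<bullet> (C *v y))" for t
    proof -
      define w where "w = x + t *\<^sub>R y"
      have ww: "w \<bullet> w = 1 + t\<^sup>2" "x \<bullet> w = 1" "w \<bullet> x = 1"
        by (simp_all add: w_def xy algebra_simps power2_eq_square)
      have pos: "0 < 1 + t\<^sup>2" by (simp add: add_pos_nonneg)
      then have "w \<noteq> 0" using ww(1) by auto
      moreover have "x \<noteq> 0" using xy by auto
      ultimately have "orthogonal_matrix (householder x ** householder w)"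
        by (intro orthogonal_matrix_mul orthogonal_householder)
      from max[OF this] have
        "0 \<le> 2 * (x \<bullet> (C *v x)) + 2 * (w \<bullet> (C *v w) - 2 * (w \<bullet> (C *v x))) / (1 + t\<^sup>2)"
        by (simp add: matrix_mul_assoc trace_mult_householder mult_householder_vec
            inner_diff_right xy ww)
      then have "0 \<le> (x \<bullet> (C *v x)) * (1 + t\<^sup>2) + (w \<bullet> (C *v w) - 2 * (w \<bullet> (C *v x)))"
        using pos by (simp add: field_simps)
      then show ?thesis
        by (simp add: w_def algebra_simps matrix_vector_mult_scaleR matrix_vector_right_distrib Cxy
            power2_eq_square)
    qed
    then show ?thesis using quadratic_nonpos_imp_linear_coeff_zero by (metis eq_iff_diff_eq_0)
  qed
  then show ?thesis unfolding transpose_def vec_eq_iff by (metis vec_lambda_beta)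
qed

lemma compact_orthogonal_matrices: "compact {W :: real^'d^'d. orthogonal_matrix W}"
proof (rule compact_eq_bounded_closed[THEN iffD2], rule conjI)
  have "norm W \<le> real CARD('d)" if "orthogonal_matrix W" for W :: "real^'d^'d"
  proof -
    have "norm (W $ i) = 1" for i
      using that by (simp add: orthogonal_matrix_orthonormal_rows row_def vec_nth_inverse)
    then show ?thesis
      using L2_set_le_sum[of UNIV "\<lambda>i. norm (W $ i)"] by (simp add: norm_vec_def[of W])
  qed
  then show "bounded {W :: real^'d^'d. orthogonal_matrix W}"
    unfolding bounded_iff by auto
  have "{W :: real^'d^'d. orthogonal_matrix W} =
      {W. \<forall>i j. (\<Sum>k\<in>UNIV. W $ k $ i * W $ k $ j) = (if i = j then 1 else 0)}"
    by (auto simp: orthogonal_matrix vec_eq_iff matrix_matrix_mult_def transpose_def mat_def)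
  also have "closed \<dots>"
    by (intro closed_Collect_all closed_Collect_eq continuous_intros)
  finally show "closed {W :: real^'d^'d. orthogonal_matrix W}" .
qed

text \<open>
  Polar decomposition, obtained variationally: a maximiser of the trace of M W exists because the
  orthogonal group is compact, and maximality makes M W symmetric (trace_max_imp_symmetric) and
  positive semidefinite (trace_max_imp_psd).
\<close>

lemma polar_decomposition:
  fixes M :: "real^'d^'d"
  obtains W where "orthogonal_matrix W" "transpose (M ** W) = M ** W"
    "\<And>v. 0 \<le> v \<bullet> ((M ** W) *v v)"
proof -
  have "continuous_on {W :: real^'d^'d. orthogonal_matrix W} (\<lambda>W. trace (M ** W))"
    unfolding trace_def matrix_matrix_mult_def by (auto intro!: continuous_intros)
  then obtain W where W: "orthogonal_matrix W"
    and max: "\<And>Q. orthogonal_matrix Q \<Longrightarrow> trace (M ** Q) \<le> trace (M ** W)"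
    using continuous_attains_sup[OF compact_orthogonal_matrices] orthogonal_matrix_id
    by (metis (mono_tags, lifting) empty_iff mem_Collect_eq)
  have "trace ((M ** W) ** Q) \<le> trace (M ** W)" if "orthogonal_matrix Q" for Q
    using max[OF orthogonal_matrix_mul[OF W that]] by (simp add: matrix_mul_assoc)
  then show ?thesis
    using that W trace_max_imp_symmetric trace_max_imp_psd by blast
qed

section \<open>Procrustes distance and Gram matrices\<close>

text \<open>
  Frobenius inner products of cross Gram matrices, which have the fixed size d, are sums over pairs of
  rows.  This is how squared norms of n x n matrices become traces of products of small ones.
\<close>

lemma sum_inner_mult_inner:
  fixes p q r s :: "nat \<Rightarrow> real^'d"
  shows "(\<Sum>k\<in>UNIV. \<Sum>l\<in>UNIV. (\<Sum>i<n. p i $ k * q i $ l) * (\<Sum>j<n. r j $ k * s j $ l)) =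
    (\<Sum>i<n. \<Sum>j<n. (p i \<bullet> r j) * (q i \<bullet> s j))"
proof -
  have "(\<Sum>k\<in>UNIV. \<Sum>l\<in>UNIV. (\<Sum>i<n. p i $ k * q i $ l) * (\<Sum>j<n. r j $ k * s j $ l)) =
    (\<Sum>k\<in>UNIV. \<Sum>l\<in>UNIV. \<Sum>i<n. \<Sum>j<n. (p i $ k * r j $ k) * (q i $ l * s j $ l))"
    by (simp add: sum_product mult_ac)
  also have "\<dots> = (\<Sum>k\<in>UNIV. \<Sum>i<n. \<Sum>j<n. \<Sum>l\<in>UNIV. (p i $ k * r j $ k) * (q i $ l * s j $ l))"
    by (subst sum.swap[of _ "{..<n}" "UNIV :: 'd set"], subst sum.swap[of _ "{..<n}" "UNIV :: 'd set"]) simp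
  also have "\<dots> = (\<Sum>i<n. \<Sum>j<n. \<Sum>k\<in>UNIV. \<Sum>l\<in>UNIV. (p i $ k * r j $ k) * (q i $ l * s j $ l))"
    by (subst sum.swap[of _ "{..<n}" "UNIV :: 'd set"], subst sum.swap[of _ "{..<n}" "UNIV :: 'd set"]) simp
  also have "\<dots> = (\<Sum>i<n. \<Sum>j<n. (p i \<bullet> r j) * (q i \<bullet> s j))"
    by (simp add: inner_vec_def sum_product)
  finally show ?thesis .
qed

definition cross_gram :: "nat \<Rightarrow> (nat \<Rightarrow> real^'d) \<Rightarrow> (nat \<Rightarrow> real^'d) \<Rightarrow> real^'d^'d" where
  "cross_gram n Z X = (\<chi> k l. \<Sum>i<n. Z i $ k * X i $ l)"

lemma cross_gram_rotate: "cross_gram n Z (\<lambda>i. X i v* W) = cross_gram n Z X ** W"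
  apply (simp add: cross_gram_def vec_eq_iff vector_matrix_mult_def matrix_matrix_mult_def
      sum_distrib_left sum_distrib_right mult.assoc)
  apply (subst sum.swap) apply simp
  done

lemma inner_cross_gram:
  "x \<bullet> (cross_gram n Z X *v y) = (\<Sum>i<n. (Z i \<bullet> x) * (X i \<bullet> y))"
proof -
  have "x \<bullet> (cross_gram n Z X *v y) =
    (\<Sum>k\<in>UNIV. \<Sum>l\<in>UNIV. \<Sum>i<n. (Z i $ k * x $ k) * (X i $ l * y $ l))"
    by (simp add: cross_gram_def inner_vec_def matrix_vector_mult_def sum_distrib_left
        sum_distrib_right mult_ac)
  also have "\<dots> = (\<Sum>i<n. \<Sum>k\<in>UNIV. \<Sum>l\<in>UNIV. (Z i $ k * x $ k) * (X i $ l * y $ l))"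
    by (simp only: sum.swap[of _ "{..<n}" "UNIV :: 'b set"])
  also have "\<dots> = (\<Sum>i<n. (Z i \<bullet> x) * (X i \<bullet> y))"
    by (simp add: inner_vec_def sum_product)
  finally show ?thesis .
qed

lemma inner_gram_matrix:
  "x \<bullet> (gram_matrix n X *v y) = (\<Sum>i<n. (X i \<bullet> x) * (X i \<bullet> y))"
  using inner_cross_gram[of x n X X y] by (simp add: gram_matrix_def cross_gram_def)

text \<open>
  The lower bound behind the Procrustes distance, for factors that are already aligned.  With
  H = Z - X one has Z Z^T - X X^T = H X^T + X H^T + H H^T.  Alignment makes K = H^T X symmetric, so the
  squared norm becomes a combination of the traces of (H^T H)^2, (H^T H) K, K^2 and
  (H^T H) (X^T X).  Of the two conditions on Z^T X, symmetry allows completing the square in H^T H and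
  K, and semidefiniteness gives a lower bound on what is left of the mixed term.
\<close>

lemma aligned_factor_bound:
  fixes Z X :: "nat \<Rightarrow> real^'d"
  assumes sym: "transpose (cross_gram n Z X) = cross_gram n Z X"
    and psd: "\<And>v. 0 \<le> v \<bullet> (cross_gram n Z X *v v)"
    and sigma: "\<And>v. \<sigma> * (v \<bullet> v) \<le> (\<Sum>i<n. (X i \<bullet> v)\<^sup>2)"
  shows "4 * \<sigma> * (\<Sum>i<n. (norm (Z i - X i))\<^sup>2) \<le> 5 * (\<Sum>i<n. \<Sum>j<n. (Z i \<bullet> Z j - X i \<bullet> X j)\<^sup>2)"
proof -
  define H where "H = (\<lambda>i. Z i - X i)"
  define a where "a i j = H i \<bullet> H j" for i j
  define b where "b i j = H i \<bullet> X j" for i j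
  define K where "K k l = (\<Sum>i<n. H i $ k * X i $ l)" for k l
  define A where "A k l = (\<Sum>i<n. H i $ k * H i $ l)" for k l
  define Sab Sbb where "Sab = (\<Sum>i<n. \<Sum>j<n. a i j * b i j)" and "Sbb = (\<Sum>i<n. \<Sum>j<n. (b i j)\<^sup>2)"
  define Saa Sbt where "Saa = (\<Sum>i<n. \<Sum>j<n. (a i j)\<^sup>2)" and "Sbt = (\<Sum>i<n. \<Sum>j<n. b i j * b j i)"
  have Ksym: "K k l = K l k" for k l
  proof -
    have "cross_gram n Z X $ k $ l = cross_gram n Z X $ l $ k"
      using arg_cong[OF sym, of "\<lambda>A. A $ l $ k"] by (simp add: transpose_def)
    then show ?thesis
      by (simp add: K_def H_def cross_gram_def algebra_simps sum_subtractf)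
  qed
  have AA: "(\<Sum>k\<in>UNIV. \<Sum>l\<in>UNIV. (A k l)\<^sup>2) = Saa"
    using sum_inner_mult_inner[where n=n and p=H and q=H and r=H and s=H] by (simp add: A_def Saa_def a_def power2_eq_square)
  have AK: "(\<Sum>k\<in>UNIV. \<Sum>l\<in>UNIV. A k l * K k l) = Sab"
    using sum_inner_mult_inner[where n=n and p=H and q=H and r=H and s=X] by (simp add: A_def K_def Sab_def a_def b_def)
  have "(\<Sum>k\<in>UNIV. \<Sum>l\<in>UNIV. (K k l)\<^sup>2) = (\<Sum>k\<in>UNIV. \<Sum>l\<in>UNIV. K k l * K l k)"
    by (intro sum.cong refl) (metis Ksym power2_eq_square)
  also have "\<dots> = Sbt"
    using sum_inner_mult_inner[where n=n and p=H and q=X and r=X and s=H]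
    by (simp add: K_def Sbt_def b_def mult.commute inner_commute)
  finally have KK: "(\<Sum>k\<in>UNIV. \<Sum>l\<in>UNIV. (K k l)\<^sup>2) = Sbt" .
  have expand: "(\<Sum>i<n. \<Sum>j<n. (Z i \<bullet> Z j - X i \<bullet> X j)\<^sup>2) = Saa + 4 * Sab + 2 * Sbt + 2 * Sbb"
  proof -
    have "Z i \<bullet> Z j - X i \<bullet> X j = a i j + b i j + b j i" for i j
      by (simp add: a_def b_def H_def inner_diff_left inner_diff_right inner_commute)
    then have "(\<Sum>i<n. \<Sum>j<n. (Z i \<bullet> Z j - X i \<bullet> X j)\<^sup>2) =
      (\<Sum>i<n. \<Sum>j<n. (a i j)\<^sup>2 + 2 * (a i j * b i j) + 2 * (a i j * b j i) + 2 * (b i j * b j i)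
        + (b i j)\<^sup>2 + (b j i)\<^sup>2)"
      by (intro sum.cong refl) (simp add: power2_eq_square algebra_simps)
    also have "\<dots> = Saa + 2 * Sab + 2 * (\<Sum>i<n. \<Sum>j<n. a i j * b j i) + 2 * Sbt + Sbb
        + (\<Sum>i<n. \<Sum>j<n. (b j i)\<^sup>2)"
      by (simp add: sum.distrib sum_distrib_left Saa_def Sab_def Sbt_def Sbb_def)
    also have "(\<Sum>i<n. \<Sum>j<n. (b j i)\<^sup>2) = Sbb"
      unfolding Sbb_def by (rule sum.swap)
    also have "(\<Sum>i<n. \<Sum>j<n. a i j * b j i) = Sab"
      unfolding Sab_def by (subst sum.swap) (simp add: a_def inner_commute)
    finally show ?thesis by simp
  qed
  have "0 \<le> (\<Sum>i<n. H i \<bullet> (cross_gram n Z X *v H i))"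
    by (intro sum_nonneg psd)
  also have "\<dots> = (\<Sum>i<n. \<Sum>j<n. (a i j + b i j) * b i j)"
    by (simp add: inner_cross_gram a_def b_def H_def inner_diff_left inner_diff_right inner_commute)
  also have "\<dots> = Sab + Sbb"
    by (simp add: Sab_def Sbb_def algebra_simps sum.distrib power2_eq_square)
  finally have psd': "0 \<le> Sab + Sbb" .
  \<comment> \<open>The optimal weights are 1 and the square root of 2; 7/5 replaces the root, at the price of
    a slightly worse constant.\<close>
  have "0 \<le> (\<Sum>k\<in>UNIV. \<Sum>l\<in>UNIV. (5 * A k l + 7 * K k l)\<^sup>2)"
    by (intro sum_nonneg) simp
  also have "\<dots> = (\<Sum>k\<in>UNIV. \<Sum>l\<in>UNIV. 25 * (A k l)\<^sup>2 + 70 * (A k l * K k l) + 49 * (K k l)\<^sup>2)"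
    by (intro sum.cong refl) (simp add: power2_eq_square algebra_simps)
  also have "\<dots> = 25 * Saa + 70 * Sab + 49 * Sbt"
    by (simp add: sum.distrib sum_distrib_left[symmetric] AA AK KK)
  finally have square: "0 \<le> 25 * Saa + 70 * Sab + 49 * Sbt" .
  have Sbt: "0 \<le> Sbt"
    unfolding KK[symmetric] by (intro sum_nonneg) simp
  have Sbb: "\<sigma> * (\<Sum>i<n. (norm (Z i - X i))\<^sup>2) \<le> Sbb"
    unfolding sum_distrib_left Sbb_def
  proof (rule sum_mono)
    show "\<sigma> * (norm (Z i - X i))\<^sup>2 \<le> (\<Sum>j<n. (b i j)\<^sup>2)" for i
    proof -
      have "b i j = X j \<bullet> (Z i - X i)" for j
        by (simp add: b_def H_def inner_commute)
      then show ?thesis using sigma[of "Z i - X i"] by (simp only: dot_square_norm)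
    qed
  qed
  show ?thesis
    unfolding expand using Sbb square psd' Sbt by argo
qed

text \<open>
  Any two factors can be aligned by the polar decomposition of Z^T X, and rotating X changes neither
  X X^T nor the least eigenvalue of X^T X.  Hence closeness of the Gram matrices forces closeness of the
  factors up to a rotation.
\<close>

lemma procrustes_sq_le:
  fixes Z X :: "nat \<Rightarrow> real^'d"
  assumes "0 < \<sigma>" and sigma: "\<And>v. \<sigma> * (v \<bullet> v) \<le> (\<Sum>i<n. (X i \<bullet> v)\<^sup>2)"
  shows "procrustes_sq n Z X \<le> 5 / (4 * \<sigma>) * (\<Sum>i<n. \<Sum>j<n. (Z i \<bullet> Z j - X i \<bullet> X j)\<^sup>2)"
proof -
  obtain W where W: "orthogonal_matrix W"
    and sym: "transpose (cross_gram n Z X ** W) = cross_gram n Z X ** W"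
    and psd: "\<And>v. 0 \<le> v \<bullet> ((cross_gram n Z X ** W) *v v)"
    by (rule polar_decomposition[of "cross_gram n Z X"]) auto
  have WW: "(x v* W) \<bullet> (y v* W) = x \<bullet> y" for x y
  proof -
    have "W *v (y v* W) = y"
      using W by (simp add: orthogonal_matrix_def matrix_vector_mul_assoc
          flip: transpose_matrix_vector)
    then show ?thesis by (simp add: dot_lmul_matrix)
  qed
  have rot: "(x v* W) \<bullet> v = x \<bullet> (W *v v)" for x v
    by (rule dot_lmul_matrix)
  have "(W *v v) \<bullet> (W *v v) = v \<bullet> v" for v
    using W by (simp add: orthogonal_matrix_def matrix_vector_mul_assoc
        flip: dot_lmul_matrix transpose_matrix_vector)
  then have sigma': "\<sigma> * (v \<bullet> v) \<le> (\<Sum>i<n. ((X i v* W) \<bullet> v)\<^sup>2)" for v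
    using sigma[of "W *v v"] by (simp add: rot)
  have "procrustes_sq n Z X \<le>
      (frobenius_norm {..<n} UNIV (\<lambda>i k. Z i $ k - (X i v* W) $ k))\<^sup>2"
    unfolding procrustes_sq_def
    by (rule cINF_lower) (auto intro!: bdd_belowI[of _ 0] W)
  also have "\<dots> = (\<Sum>i<n. (norm (Z i - X i v* W))\<^sup>2)"
    by (simp add: frobenius_norm_def sum_nonneg flip: dot_square_norm)
       (simp add: inner_vec_def power2_eq_square)
  also have "\<dots> \<le> 5 / (4 * \<sigma>) * (\<Sum>i<n. \<Sum>j<n. (Z i \<bullet> Z j - (X i v* W) \<bullet> (X j v* W))\<^sup>2)"
    using aligned_factor_bound[of n Z "\<lambda>i. X i v* W" \<sigma>] sym psd sigma' \<open>0 < \<sigma>\<close>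
    by (simp add: cross_gram_rotate field_simps)
  finally show ?thesis by (simp add: WW)
qed

section \<open>Orthonormal systems and spectral truncation\<close>

lemma orthonormal_sum_inner:
  assumes "gram_matrix n U = mat 1"
  shows "(\<Sum>i<n. (U i \<bullet> x) * (U i \<bullet> y)) = x \<bullet> y"
  using inner_gram_matrix[of x n U y] assms by simp

lemma orthonormal_expansion:
  fixes U :: "nat \<Rightarrow> real^'d"
  assumes "gram_matrix n U = mat 1"
  shows "(\<Sum>i<n. (U i \<bullet> y) *\<^sub>R U i) = y"
proof -
  have "(\<Sum>i<n. (U i \<bullet> y) *\<^sub>R U i) \<bullet> x = y \<bullet> x" for x
    using orthonormal_sum_inner[OF assms, of y x] by (simp add: inner_sum_left)
  then show ?thesis using vector_eq_rdot by blast
qed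

text \<open>
  Pythagoras for the projection of a vector a onto the column space of U.  The coordinate vector
  U^T a is kept as an element of the fixed-dimensional space, which is what makes the
  n-dimensional computation short.
\<close>

lemma orthonormal_residual:
  fixes U :: "nat \<Rightarrow> real^'d"
  assumes "gram_matrix n U = mat 1"
  shows "(\<Sum>i<n. (a i - U i \<bullet> (\<Sum>m<n. a m *\<^sub>R U m))\<^sup>2) =
    (\<Sum>i<n. (a i)\<^sup>2) - (norm (\<Sum>m<n. a m *\<^sub>R U m))\<^sup>2"
proof -
  define w where "w = (\<Sum>m<n. a m *\<^sub>R U m)"
  have "(\<Sum>i<n. (a i - U i \<bullet> w)\<^sup>2) =
    (\<Sum>i<n. (a i)\<^sup>2) - 2 * (\<Sum>i<n. a i * (U i \<bullet> w)) + (\<Sum>i<n. (U i \<bullet> w) * (U i \<bullet> w))"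
    by (simp add: power2_eq_square algebra_simps sum.distrib sum_subtractf sum_distrib_left)
  also have "(\<Sum>i<n. a i * (U i \<bullet> w)) = w \<bullet> w"
    by (subst (2) w_def) (simp add: inner_sum_left)
  also have "(\<Sum>i<n. (U i \<bullet> w) * (U i \<bullet> w)) = w \<bullet> w"
    by (rule orthonormal_sum_inner[OF assms])
  finally show ?thesis by (simp add: w_def dot_square_norm)
qed

lemma orthonormal_bessel:
  fixes U :: "nat \<Rightarrow> real^'d"
  assumes "gram_matrix n U = mat 1"
  shows "(norm (\<Sum>m<n. a m *\<^sub>R U m))\<^sup>2 \<le> (\<Sum>i<n. (a i)\<^sup>2)"
proof -
  have "0 \<le> (\<Sum>i<n. (a i - U i \<bullet> (\<Sum>m<n. a m *\<^sub>R U m))\<^sup>2)" by (intro sum_nonneg) simp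
  then show ?thesis unfolding orthonormal_residual[OF assms] by simp
qed

lemma orthonormal_column_norm:
  fixes U :: "nat \<Rightarrow> real^'d"
  assumes "gram_matrix n U = mat 1"
  shows "(\<Sum>i<n. (U i $ k)\<^sup>2) = 1"
  using orthonormal_sum_inner[OF assms, of "axis k 1" "axis k 1"]
  by (simp add: inner_axis power2_eq_square inner_axis_axis)

text \<open>
  Eigenvectors come as a family indexed by numbers, and only some of them are collected in a matrix
  with columns indexed by the fixed type, so orthonormality is also needed in this form.
\<close>

definition orthonormal_family :: "nat \<Rightarrow> nat set \<Rightarrow> (nat \<Rightarrow> nat \<Rightarrow> real) \<Rightarrow> bool" where
  "orthonormal_family n K u \<longleftrightarrow>
    (\<forall>j\<in>K. \<forall>k\<in>K. (\<Sum>i<n. u j i * u k i) = (if j = k then 1 else 0))"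

lemma orthonormal_family_norm:
  fixes c :: "nat \<Rightarrow> 'v::real_inner"
  assumes "orthonormal_family n K u" "finite K"
  shows "(\<Sum>i<n. (norm (\<Sum>k\<in>K. u k i *\<^sub>R c k))\<^sup>2) = (\<Sum>k\<in>K. (norm (c k))\<^sup>2)"
proof -
  have "(\<Sum>i<n. (norm (\<Sum>k\<in>K. u k i *\<^sub>R c k))\<^sup>2) =
    (\<Sum>i<n. \<Sum>j\<in>K. \<Sum>k\<in>K. u j i * u k i * (c j \<bullet> c k))"
    by (simp add: inner_sum_left inner_sum_right sum_distrib_left mult.left_commute mult.assoc flip: dot_square_norm,
        intro sum.cong refl, simp add: inner_commute)
  also have "\<dots> = (\<Sum>j\<in>K. \<Sum>k\<in>K. \<Sum>i<n. u j i * u k i * (c j \<bullet> c k))"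
    by (simp only: sum.swap[of _ _ "{..<n}"])
  also have "\<dots> = (\<Sum>j\<in>K. \<Sum>k\<in>K. if j = k then c j \<bullet> c k else 0)"
    using assms(1) unfolding sum_distrib_right[symmetric] orthonormal_family_def
    by (intro sum.cong refl) auto
  also have "\<dots> = (\<Sum>k\<in>K. (norm (c k))\<^sup>2)"
    using assms(2) by (simp add: dot_square_norm)
  finally show ?thesis .
qed

lemma orthonormal_family_bessel:
  assumes "orthonormal_family n K u" "finite K"
  shows "(\<Sum>k\<in>K. (\<Sum>i<n. u k i * b i)\<^sup>2) \<le> (\<Sum>i<n. (b i)\<^sup>2)"
proof -
  define c where "c k = (\<Sum>i<n. u k i * b i)" for k
  have "0 \<le> (\<Sum>i<n. (b i - (\<Sum>k\<in>K. u k i *\<^sub>R c k))\<^sup>2)" by (intro sum_nonneg) simp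
  also have "\<dots> = (\<Sum>i<n. (b i)\<^sup>2) - 2 * (\<Sum>i<n. \<Sum>k\<in>K. u k i * b i * c k)
      + (\<Sum>i<n. (norm (\<Sum>k\<in>K. u k i *\<^sub>R c k))\<^sup>2)"
    by (simp add: power2_diff sum.distrib sum_subtractf sum_distrib_left mult_ac)
  also have "(\<Sum>i<n. \<Sum>k\<in>K. u k i * b i * c k) = (\<Sum>k\<in>K. (c k)\<^sup>2)"
    by (subst sum.swap) (simp add: c_def power2_eq_square flip: sum_distrib_right)
  finally show ?thesis
    unfolding orthonormal_family_norm[OF assms] by (simp add: c_def)
qed

lemma frobenius_sum_orthonormal_family:
  assumes "orthonormal_family n K u" "finite K"
  shows "(\<Sum>i<n. \<Sum>j<n. (\<Sum>k\<in>K. l k * u k i * u k j)\<^sup>2) = (\<Sum>k\<in>K. (l k)\<^sup>2)"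
proof -
  have "(\<Sum>j<n. (\<Sum>k\<in>K. l k * u k i * u k j)\<^sup>2) = (\<Sum>k\<in>K. (l k * u k i)\<^sup>2)" for i
    using orthonormal_family_norm[OF assms, of "\<lambda>k. l k * u k i"] by (simp add: mult_ac)
  then have "(\<Sum>i<n. \<Sum>j<n. (\<Sum>k\<in>K. l k * u k i * u k j)\<^sup>2) = (\<Sum>i<n. \<Sum>k\<in>K. (l k * u k i)\<^sup>2)"
    by simp
  also have "\<dots> = (\<Sum>k\<in>K. \<Sum>i<n. (l k * u k i)\<^sup>2)"
    by (rule sum.swap)
  also have "\<dots> = (\<Sum>k\<in>K. (l k)\<^sup>2 * (\<Sum>i<n. u k i * u k i))"
    by (simp add: sum_distrib_left power2_eq_square mult_ac)
  also have "\<dots> = (\<Sum>k\<in>K. (l k)\<^sup>2)"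
    using assms(1) by (intro sum.cong) (auto simp: orthonormal_family_def)
  finally show ?thesis .
qed

text \<open>
  Subtracting s d from every term leaves positive terms only at indices below d, where a weight cannot
  exceed 1; what has been subtracted is controlled by the total weight.
\<close>

lemma weighted_sum_le_leading_sum:
  fixes s q :: "nat \<Rightarrow> real"
  assumes dec: "\<And>j k. j \<le> k \<Longrightarrow> k < n \<Longrightarrow> s k \<le> s j"
    and s: "\<And>k. k < n \<Longrightarrow> 0 \<le> s k" and q: "\<And>k. k < n \<Longrightarrow> 0 \<le> q k \<and> q k \<le> 1"
    and total: "(\<Sum>k<n. q k) \<le> real d" and dn: "d \<le> n"
  shows "(\<Sum>k<n. s k * q k) \<le> (\<Sum>k<d. s k)"
proof (cases "d = n")
  case True
  then show ?thesis using s q by (auto intro!: sum_mono mult_left_le)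
next
  case False
  with dn have dn': "d < n" by simp
  have "(\<Sum>k<n. s k * q k) = (\<Sum>k<n. (s k - s d) * q k) + s d * (\<Sum>k<n. q k)"
    by (simp add: algebra_simps sum.distrib sum_subtractf sum_distrib_left)
  also have "\<dots> \<le> (\<Sum>k<n. if k < d then s k - s d else 0) + s d * real d"
  proof (intro add_mono sum_mono mult_left_mono total s dn')
    fix k assume k: "k \<in> {..<n}"
    show "(s k - s d) * q k \<le> (if k < d then s k - s d else 0)"
    proof (cases "k < d")
      case True
      then show ?thesis using dec[of k d] dn' q[of k] k by (auto intro!: mult_left_le)
    next
      case False
      then show ?thesis using dec[of d k] q[of k] k by (auto intro!: mult_nonpos_nonneg)
    qed
  qed
  also have "(\<Sum>k<n. if k < d then s k - s d else 0) = (\<Sum>k<d. s k - s d)"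
    using dn' by (intro sum.mono_neutral_cong_right) auto
  finally show ?thesis by (simp add: sum_subtractf mult.commute)
qed

text \<open>
  Half of the Eckart--Young theorem: no matrix whose columns lie in the d-dimensional range of U
  approximates P better than truncating its spectrum.  Applying the projection orthogonal to U
  removes the competitor and leaves the part of P outside U; what U can
  capture of the squared eigenvalues is bounded by the weights q k, the squared lengths of the
  projected eigenvectors, which are at most 1 and add up to at most d.
\<close>

lemma eckart_young_tail:
  fixes U :: "nat \<Rightarrow> real^'d" and y :: "nat \<Rightarrow> real^'d"
  assumes U: "gram_matrix n U = mat 1"
    and sd: "spectral_decomposition n P lam u"
    and lam: "\<And>k. k < n \<Longrightarrow> 0 \<le> lam k"
    and dn: "CARD('d) \<le> n"
  shows "(\<Sum>k=CARD('d)..<n. (lam k)\<^sup>2) \<le> (\<Sum>i<n. \<Sum>j<n. (P i j - U i \<bullet> y j)\<^sup>2)"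
proof -
  let ?d = "CARD('d)"
  have on: "orthonormal_family n {..<n} u"
    and dec: "\<And>j k. j \<le> k \<Longrightarrow> k < n \<Longrightarrow> lam k \<le> lam j"
    and P: "\<And>i j. i < n \<Longrightarrow> j < n \<Longrightarrow> P i j = (\<Sum>k<n. lam k * u k i * u k j)"
    using sd unfolding spectral_decomposition_def orthonormal_family_def by auto
  define c where "c k = (\<Sum>m<n. u k m *\<^sub>R U m)" for k
  define q where "q k = (norm (c k))\<^sup>2" for k
  have q1: "q k \<le> 1" if "k < n" for k
    using orthonormal_bessel[OF U, of "u k"] on that
    by (simp add: q_def c_def orthonormal_family_def power2_eq_square)
  have q_total: "(\<Sum>k<n. q k) \<le> real ?d"
  proof -
    have "(\<Sum>k<n. q k) = (\<Sum>k<n. \<Sum>l\<in>UNIV. (\<Sum>m<n. u k m * U m $ l)\<^sup>2)"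
      unfolding q_def c_def dot_square_norm[symmetric] inner_vec_def
      by (simp add: power2_eq_square)
    also have "\<dots> = (\<Sum>l\<in>UNIV. \<Sum>k<n. (\<Sum>m<n. u k m * U m $ l)\<^sup>2)"
      by (rule sum.swap)
    also have "\<dots> \<le> (\<Sum>l\<in>UNIV. \<Sum>m<n. (U m $ l)\<^sup>2)"
      by (intro sum_mono orthonormal_family_bessel[OF on]) simp
    also have "\<dots> = real ?d"
      by (simp add: orthonormal_column_norm[OF U])
    finally show ?thesis .
  qed
  have col: "(\<Sum>m<n. P m j *\<^sub>R U m) = (\<Sum>k<n. u k j *\<^sub>R (lam k *\<^sub>R c k))" if "j < n" for j
  proof -
    have "(\<Sum>m<n. P m j *\<^sub>R U m) = (\<Sum>m<n. \<Sum>k<n. (lam k * u k m * u k j) *\<^sub>R U m)"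
      using that by (simp add: P scaleR_sum_left)
    also have "\<dots> = (\<Sum>k<n. \<Sum>m<n. (lam k * u k m * u k j) *\<^sub>R U m)"
      by (rule sum.swap)
    also have "\<dots> = (\<Sum>k<n. u k j *\<^sub>R (lam k *\<^sub>R c k))"
      by (simp add: c_def scaleR_sum_right mult_ac)
    finally show ?thesis .
  qed
  have proj: "(\<Sum>j<n. (norm (\<Sum>m<n. P m j *\<^sub>R U m))\<^sup>2) = (\<Sum>k<n. (lam k)\<^sup>2 * q k)"
    using orthonormal_family_norm[OF on, of "\<lambda>k. lam k *\<^sub>R c k"]
    by (simp add: col q_def power_mult_distrib)
  have total: "(\<Sum>j<n. \<Sum>i<n. (P i j)\<^sup>2) = (\<Sum>k<n. (lam k)\<^sup>2)"
    using frobenius_sum_orthonormal_family[OF on, of lam] by (subst sum.swap) (simp add: P)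
  have "(\<Sum>k<n. (lam k)\<^sup>2 * q k) \<le> (\<Sum>k<?d. (lam k)\<^sup>2)"
    by (rule weighted_sum_le_leading_sum)
       (use dec lam q1 q_total dn in \<open>auto intro!: power_mono simp: q_def\<close>)
  then have "(\<Sum>k=?d..<n. (lam k)\<^sup>2) \<le> (\<Sum>k<n. (lam k)\<^sup>2) - (\<Sum>k<n. (lam k)\<^sup>2 * q k)"
    using sum.atLeastLessThan_concat[of 0 ?d n "\<lambda>k. (lam k)\<^sup>2"] dn
    by (simp add: atLeast0LessThan)
  also have "\<dots> = (\<Sum>j<n. \<Sum>i<n. (P i j - U i \<bullet> (\<Sum>m<n. P m j *\<^sub>R U m))\<^sup>2)"
    by (simp add: orthonormal_residual[OF U] sum_subtractf total proj)
  also have "\<dots> = (\<Sum>j<n. \<Sum>i<n. ((P i j - U i \<bullet> y j) - U i \<bullet> (\<Sum>m<n. (P m j - U m \<bullet> y j) *\<^sub>R U m))\<^sup>2)"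
    by (simp add: scaleR_diff_left sum_subtractf orthonormal_expansion[OF U] inner_diff_right)
  also have "\<dots> \<le> (\<Sum>j<n. \<Sum>i<n. (P i j - U i \<bullet> y j)\<^sup>2)"
    by (rule sum_mono) (subst orthonormal_residual[OF U], simp)
  also have "\<dots> = (\<Sum>i<n. \<Sum>j<n. (P i j - U i \<bullet> y j)\<^sup>2)"
    by (rule sum.swap)
  finally show ?thesis .
qed

section \<open>Perturbation of the leading eigenspace\<close>

text \<open>
  Both sides equal twice the dimension minus twice the overlap of the two column spaces.
\<close>

lemma projector_distance:
  fixes U V :: "nat \<Rightarrow> real^'d"
  assumes U: "gram_matrix n U = mat 1" and V: "gram_matrix n V = mat 1"
  shows "(\<Sum>i<n. \<Sum>j<n. (V i \<bullet> V j - U i \<bullet> U j)\<^sup>2) =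
    2 * (\<Sum>l\<in>UNIV. \<Sum>i<n. (U i $ l - V i \<bullet> (\<Sum>m<n. U m $ l *\<^sub>R V m))\<^sup>2)"
proof -
  define cr where "cr = (\<Sum>i<n. \<Sum>j<n. (U i \<bullet> U j) * (V i \<bullet> V j))"
  have self: "(\<Sum>i<n. \<Sum>j<n. (A i \<bullet> A j) * (A i \<bullet> A j)) = real CARD('d)"
    if A: "gram_matrix n A = mat 1" for A :: "nat \<Rightarrow> real^'d"
  proof -
    have "(\<Sum>i<n. \<Sum>j<n. (A i \<bullet> A j) * (A i \<bullet> A j)) = (\<Sum>i<n. \<Sum>j<n. (A j \<bullet> A i) * (A j \<bullet> A i))"
      by (simp add: inner_commute)
    also have "\<dots> = (\<Sum>i<n. A i \<bullet> A i)"
      by (simp add: orthonormal_sum_inner[OF A])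
    also have "\<dots> = (\<Sum>l\<in>UNIV. \<Sum>i<n. (A i $ l)\<^sup>2)"
      by (subst sum.swap) (simp add: inner_vec_def power2_eq_square)
    finally show ?thesis by (simp add: orthonormal_column_norm[OF A])
  qed
  have norms: "(\<Sum>l\<in>UNIV. (norm (\<Sum>m<n. U m $ l *\<^sub>R V m))\<^sup>2) = cr"
  proof -
    have "(\<Sum>l\<in>UNIV. (norm (\<Sum>m<n. U m $ l *\<^sub>R V m))\<^sup>2) =
      (\<Sum>l\<in>UNIV. \<Sum>i<n. \<Sum>j<n. U i $ l * U j $ l * (V i \<bullet> V j))"
      by (simp add: inner_sum_left inner_sum_right sum_distrib_left mult_ac inner_commute
          flip: dot_square_norm)
    also have "\<dots> = (\<Sum>i<n. \<Sum>j<n. \<Sum>l\<in>UNIV. U i $ l * U j $ l * (V i \<bullet> V j))"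
      by (simp only: sum.swap[of _ "{..<n}" "UNIV :: 'd set"])
    finally show ?thesis by (simp add: cr_def inner_vec_def[of "U _"] sum_distrib_right)
  qed
  have "(\<Sum>i<n. \<Sum>j<n. (V i \<bullet> V j - U i \<bullet> U j)\<^sup>2) =
    (\<Sum>i<n. \<Sum>j<n. (V i \<bullet> V j) * (V i \<bullet> V j)) + (\<Sum>i<n. \<Sum>j<n. (U i \<bullet> U j) * (U i \<bullet> U j)) - 2 * cr"
    by (simp add: cr_def power2_eq_square algebra_simps sum.distrib sum_subtractf sum_distrib_left)
  then have "(\<Sum>i<n. \<Sum>j<n. (V i \<bullet> V j - U i \<bullet> U j)\<^sup>2) = 2 * (real CARD('d) - cr)"
    by (simp add: self U V)
  also have "real CARD('d) - cr = (\<Sum>l\<in>UNIV. \<Sum>i<n. (U i $ l - V i \<bullet> (\<Sum>m<n. U m $ l *\<^sub>R V m))\<^sup>2)"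
    by (simp add: orthonormal_residual[OF V] sum_subtractf norms orthonormal_column_norm[OF U])
  finally show ?thesis .
qed

text \<open>
  A sin-theta theorem for a matrix that factors through V, compared with U diag(t) U^T.
  Projecting the difference orthogonally to V annihilates the first matrix, and on the second
  one it leaves the part of U outside V, magnified by at least \<open>\<sigma>\<close>.
\<close>

lemma sin_theta_bound:
  fixes U V z :: "nat \<Rightarrow> real^'d" and t :: "real^'d"
  assumes U: "gram_matrix n U = mat 1" and V: "gram_matrix n V = mat 1"
    and t: "\<And>l. \<sigma> \<le> t $ l" and "0 \<le> \<sigma>"
  shows "\<sigma>\<^sup>2 * (\<Sum>i<n. \<Sum>j<n. (V i \<bullet> V j - U i \<bullet> U j)\<^sup>2) \<le>
    2 * (\<Sum>i<n. \<Sum>j<n. (V i \<bullet> z j - U i \<bullet> (\<chi> l. t $ l * U j $ l))\<^sup>2)"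
proof -
  define y where "y j = (\<chi> l. t $ l * U j $ l)" for j
  define G where "G i = (\<chi> l. U i $ l - V i \<bullet> (\<Sum>m<n. U m $ l *\<^sub>R V m))" for i
  have res: "U i \<bullet> y j - V i \<bullet> (\<Sum>m<n. (U m \<bullet> y j) *\<^sub>R V m) = U j \<bullet> (\<chi> l. t $ l * G i $ l)" for i j
  proof -
    have "V i \<bullet> (\<Sum>m<n. (U m \<bullet> y j) *\<^sub>R V m) = (\<Sum>m<n. \<Sum>l\<in>UNIV. U m $ l * y j $ l * (V i \<bullet> V m))"
      by (simp add: inner_sum_right inner_vec_def[of "U _"] sum_distrib_right)
    also have "\<dots> = (\<Sum>l\<in>UNIV. \<Sum>m<n. U m $ l * y j $ l * (V i \<bullet> V m))"
      by (rule sum.swap)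
    also have "\<dots> = (\<Sum>l\<in>UNIV. y j $ l * (V i \<bullet> (\<Sum>m<n. U m $ l *\<^sub>R V m)))"
      by (simp add: inner_sum_right sum_distrib_left mult_ac)
    finally show ?thesis
      by (simp add: y_def G_def inner_vec_def[of "U _"] sum_subtractf[symmetric] algebra_simps)
  qed
  have "(\<Sum>i<n. \<Sum>j<n. (V i \<bullet> V j - U i \<bullet> U j)\<^sup>2) = 2 * (\<Sum>l\<in>UNIV. \<Sum>i<n. (G i $ l)\<^sup>2)"
    by (simp add: projector_distance[OF U V] G_def)
  also have "(\<Sum>l\<in>UNIV. \<Sum>i<n. (G i $ l)\<^sup>2) = (\<Sum>i<n. \<Sum>l\<in>UNIV. (G i $ l)\<^sup>2)"
    by (rule sum.swap)
  finally have "\<sigma>\<^sup>2 * (\<Sum>i<n. \<Sum>j<n. (V i \<bullet> V j - U i \<bullet> U j)\<^sup>2) =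
      2 * (\<Sum>i<n. \<Sum>l\<in>UNIV. \<sigma>\<^sup>2 * (G i $ l)\<^sup>2)"
    by (simp add: sum_distrib_left mult.left_commute)
  also have "\<dots> \<le> 2 * (\<Sum>i<n. \<Sum>l\<in>UNIV. (t $ l)\<^sup>2 * (G i $ l)\<^sup>2)"
    using t \<open>0 \<le> \<sigma>\<close> by (intro mult_left_mono sum_mono mult_right_mono power_mono) auto
  also have "\<dots> = 2 * (\<Sum>i<n. (\<chi> l. t $ l * G i $ l) \<bullet> (\<chi> l. t $ l * G i $ l))"
    by (simp add: inner_vec_def power2_eq_square mult_ac)
  also have "\<dots> = 2 * (\<Sum>i<n. \<Sum>j<n. (U i \<bullet> y j - V i \<bullet> (\<Sum>m<n. (U m \<bullet> y j) *\<^sub>R V m))\<^sup>2)"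
    by (simp add: res power2_eq_square orthonormal_sum_inner[OF U])
  also have "\<dots> = 2 * (\<Sum>j<n. \<Sum>i<n. (U i \<bullet> y j - V i \<bullet> (\<Sum>m<n. (U m \<bullet> y j) *\<^sub>R V m))\<^sup>2)"
    by (subst sum.swap) simp
  also have "\<dots> = 2 * (\<Sum>j<n. \<Sum>i<n. ((U i \<bullet> y j - V i \<bullet> z j) -
      V i \<bullet> (\<Sum>m<n. (U m \<bullet> y j - V m \<bullet> z j) *\<^sub>R V m))\<^sup>2)"
    by (simp add: scaleR_diff_left sum_subtractf orthonormal_expansion[OF V] inner_diff_right)
  also have "\<dots> \<le> 2 * (\<Sum>j<n. \<Sum>i<n. (U i \<bullet> y j - V i \<bullet> z j)\<^sup>2)"
    by (rule mult_left_mono, rule sum_mono, subst orthonormal_residual[OF V]) simp_all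
  also have "\<dots> = 2 * (\<Sum>i<n. \<Sum>j<n. (V i \<bullet> z j - U i \<bullet> y j)\<^sup>2)"
    by (subst sum.swap) (simp add: power2_commute)
  finally show ?thesis by (simp add: y_def)
qed

text \<open>
  The squared singular values are the values of the quadratic form of X^T X at the right
  singular vectors, so they inherit its lower bound.
\<close>

lemma left_singular_vectors_gram:
  fixes X U :: "nat \<Rightarrow> real^'d"
  assumes svd: "left_singular_vectors n X U"
    and sigma: "\<And>v. \<sigma> * (v \<bullet> v) \<le> (\<Sum>i<n. (X i \<bullet> v)\<^sup>2)"
  obtains t :: "real^'d" where "\<And>l. \<sigma> \<le> t $ l"
    "\<And>i j. i < n \<Longrightarrow> j < n \<Longrightarrow> X i \<bullet> X j = U i \<bullet> (\<chi> l. t $ l * U j $ l)"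
proof -
  from svd obtain s :: "real^'d" and V :: "real^'d^'d" where V: "orthogonal_matrix V"
    and X: "\<And>i k. i < n \<Longrightarrow> X i $ k = (\<Sum>l\<in>UNIV. U i $ l * s $ l * V $ k $ l)"
    and U: "gram_matrix n U = mat 1"
    unfolding left_singular_vectors_def by blast
  have XV: "X i = V *v (\<chi> l. s $ l * U i $ l)" if "i < n" for i
    using that by (simp add: X vec_eq_iff matrix_vector_mult_def mult_ac)
  have VV: "(V *v x) \<bullet> (V *v y) = x \<bullet> y" for x y
    using V by (simp add: orthogonal_matrix_def matrix_vector_mul_assoc
        flip: dot_lmul_matrix transpose_matrix_vector)
  have "\<sigma> \<le> (s $ l)\<^sup>2" for l
  proof -
    define x where "x = (axis l 1 :: real^'d)"
    have "\<sigma> * ((V *v x) \<bullet> (V *v x)) \<le> (\<Sum>i<n. ((V *v (\<chi> l. s $ l * U i $ l)) \<bullet> (V *v x))\<^sup>2)"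
      using sigma[of "V *v x"] by (simp add: XV)
    also have "\<dots> = (\<Sum>i<n. (s $ l)\<^sup>2 * (U i $ l)\<^sup>2)"
      unfolding VV by (simp add: x_def inner_axis power_mult_distrib)
    also have "\<dots> = (s $ l)\<^sup>2"
      by (simp add: orthonormal_column_norm[OF U] flip: sum_distrib_left)
    finally show ?thesis unfolding VV by (simp add: x_def inner_axis_axis)
  qed
  moreover have "X i \<bullet> X j = U i \<bullet> (\<chi> l. (\<chi> l. (s $ l)\<^sup>2) $ l * U j $ l)" if "i < n" "j < n" for i j
    using that by (simp add: XV VV) (simp add: inner_vec_def power2_eq_square mult_ac)
  ultimately show ?thesis using that[of "\<chi> l. (s $ l)\<^sup>2"] by simp
qed

lemma spectral_embedding_inner:
  fixes e :: "'d::finite \<Rightarrow> nat"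
  assumes e: "bij_betw e UNIV {..<CARD('d)}" and lam: "\<And>k. k < CARD('d) \<Longrightarrow> 0 \<le> lam k"
  shows "spectral_embedding e lam u i \<bullet> spectral_embedding e lam u j =
    (\<Sum>k<CARD('d). lam k * u k i * u k j)"
proof -
  have "e k < CARD('d)" for k using e by (auto simp: bij_betw_def)
  then have "sqrt (lam (e k)) * sqrt (lam (e k)) = lam (e k)" for k
    using lam by simp
  then have "spectral_embedding e lam u i \<bullet> spectral_embedding e lam u j =
    (\<Sum>k\<in>UNIV. lam (e k) * u (e k) i * u (e k) j)"
    unfolding spectral_embedding_def inner_vec_def by (intro sum.cong refl) (simp add: mult_ac)
  then show ?thesis
    using sum.reindex_bij_betw[OF e, of "\<lambda>k. lam k * u k i * u k j"] by simp
qed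

lemma leading_eigenvectors_orthonormal:
  fixes e :: "'d::finite \<Rightarrow> nat"
  assumes e: "bij_betw e UNIV {..<CARD('d)}" and "CARD('d) \<le> n"
    and sd: "spectral_decomposition n P lam u"
  shows "gram_matrix n (leading_eigenvectors e u) = mat 1"
proof -
  have "e k < n" for k using e assms(2) by (auto simp: bij_betw_def dest: less_le_trans)
  moreover have "e k = e l \<longleftrightarrow> k = l" for k l
    using e by (auto simp: bij_betw_def inj_on_def)
  ultimately show ?thesis
    using sd by (simp add: gram_matrix_def leading_eigenvectors_def mat_def vec_eq_iff
        spectral_decomposition_def)
qed

text \<open>
  The deterministic situation: a positive semidefinite matrix P is compared with the rank d Gram
  matrix of X, whose smallest positive eigenvalue is at least \<open>\<sigma>\<close>.
\<close>

locale spectral_perturbation =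
  fixes n :: nat and X U :: "nat \<Rightarrow> real^'d" and e :: "'d \<Rightarrow> nat" and P lam u \<sigma>
  assumes dn: "CARD('d) \<le> n" and e: "bij_betw e UNIV {..<CARD('d)}"
    and sd: "spectral_decomposition n P lam u" and lam: "\<And>k. k < n \<Longrightarrow> 0 \<le> lam k"
    and svd: "left_singular_vectors n X U"
    and sigma: "\<And>v. \<sigma> * (v \<bullet> v) \<le> (\<Sum>i<n. (X i \<bullet> v)\<^sup>2)" and sigma_pos: "0 < \<sigma>"
begin

definition err :: real where "err = (\<Sum>i<n. \<Sum>j<n. (P i j - X i \<bullet> X j)\<^sup>2)"

lemma orthonormal_U: "gram_matrix n U = mat 1"
  using svd by (simp add: left_singular_vectors_def)

text \<open>
  The Gram matrix of the embedding is the spectral truncation of P, which is as close to P as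
  the Gram matrix of X is, or closer; passing through P costs a factor 2 in norm.
\<close>

lemma embedding_gram_error:
  "(\<Sum>i<n. \<Sum>j<n. (spectral_embedding e lam u i \<bullet> spectral_embedding e lam u j - X i \<bullet> X j)\<^sup>2)
    \<le> 4 * err"
proof -
  let ?d = "CARD('d)"
  obtain t :: "real^'d"
    where t: "\<And>i j. i < n \<Longrightarrow> j < n \<Longrightarrow> X i \<bullet> X j = U i \<bullet> (\<chi> l. t $ l * U j $ l)"
    using left_singular_vectors_gram[OF svd sigma] by metis
  have "(\<Sum>k=?d..<n. (lam k)\<^sup>2) \<le> (\<Sum>i<n. \<Sum>j<n. (P i j - U i \<bullet> (\<chi> l. t $ l * U j $ l))\<^sup>2)"
    by (rule eckart_young_tail[OF orthonormal_U sd lam dn])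
  then have tail: "(\<Sum>k=?d..<n. (lam k)\<^sup>2) \<le> err"
    by (simp add: err_def t)
  have on: "orthonormal_family n {?d..<n} u"
    using sd by (simp add: orthonormal_family_def spectral_decomposition_def)
  have diff: "spectral_embedding e lam u i \<bullet> spectral_embedding e lam u j =
      P i j - (\<Sum>k=?d..<n. lam k * u k i * u k j)" if "i < n" "j < n" for i j
  proof -
    have "P i j = (\<Sum>k<n. lam k * u k i * u k j)"
      using sd that by (simp add: spectral_decomposition_def)
    also have "\<dots> = (\<Sum>k<?d. lam k * u k i * u k j) + (\<Sum>k=?d..<n. lam k * u k i * u k j)"
      using sum.atLeastLessThan_concat[of 0 ?d n "\<lambda>k. lam k * u k i * u k j"] dn
      by (simp add: atLeast0LessThan)
    finally show ?thesis
      using lam dn by (simp add: spectral_embedding_inner[OF e])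
  qed
  have sq: "(a - b)\<^sup>2 \<le> 2 * a\<^sup>2 + 2 * b\<^sup>2" for a b :: real
    using zero_le_power2[of "a + b"] by (simp add: power2_eq_square algebra_simps)
  have "(\<Sum>i<n. \<Sum>j<n. (spectral_embedding e lam u i \<bullet> spectral_embedding e lam u j - X i \<bullet> X j)\<^sup>2) \<le>
    (\<Sum>i<n. \<Sum>j<n. 2 * (P i j - X i \<bullet> X j)\<^sup>2 + 2 * (\<Sum>k=?d..<n. lam k * u k i * u k j)\<^sup>2)"
  proof (intro sum_mono)
    fix i j assume "i \<in> {..<n}" "j \<in> {..<n}"
    then show "(spectral_embedding e lam u i \<bullet> spectral_embedding e lam u j - X i \<bullet> X j)\<^sup>2 \<le>
        2 * (P i j - X i \<bullet> X j)\<^sup>2 + 2 * (\<Sum>k=?d..<n. lam k * u k i * u k j)\<^sup>2"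
      using sq[of "P i j - X i \<bullet> X j" "\<Sum>k=?d..<n. lam k * u k i * u k j"]
      by (simp add: diff algebra_simps)
  qed
  also have "\<dots> = 2 * err + 2 * (\<Sum>k=?d..<n. (lam k)\<^sup>2)"
    by (simp add: sum.distrib err_def frobenius_sum_orthonormal_family[OF on]
        flip: sum_distrib_left)
  finally show ?thesis using tail by simp
qed

lemma embedding_procrustes: "procrustes_sq n (spectral_embedding e lam u) X \<le> 5 / \<sigma> * err"
proof -
  have "procrustes_sq n (spectral_embedding e lam u) X \<le> 5 / (4 * \<sigma>) *
    (\<Sum>i<n. \<Sum>j<n. (spectral_embedding e lam u i \<bullet> spectral_embedding e lam u j - X i \<bullet> X j)\<^sup>2)"
    by (rule procrustes_sq_le[OF sigma_pos sigma])
  also have "\<dots> \<le> 5 / (4 * \<sigma>) * (4 * err)"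
    using sigma_pos by (intro mult_left_mono embedding_gram_error) auto
  finally show ?thesis by simp
qed

text \<open>
  The sin-theta bound is applied to the truncation of P, which has its columns in the span of the
  leading eigenvectors.  Comparing the projections instead of the factors themselves puts
  the constant 1 in the place of \<open>\<sigma>\<close> in the Procrustes bound.
\<close>

lemma eigenvectors_procrustes: "procrustes_sq n (leading_eigenvectors e u) U \<le> 10 / \<sigma>\<^sup>2 * err"
proof -
  let ?V = "leading_eigenvectors e u"
  have V: "gram_matrix n ?V = mat 1"
    by (rule leading_eigenvectors_orthonormal[OF e dn sd])
  obtain t :: "real^'d" where t: "\<And>l. \<sigma> \<le> t $ l"
    and Xt: "\<And>i j. i < n \<Longrightarrow> j < n \<Longrightarrow> X i \<bullet> X j = U i \<bullet> (\<chi> l. t $ l * U j $ l)"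
    using left_singular_vectors_gram[OF svd sigma] by metis
  define z where "z j = (\<chi> k. lam (e k) * u (e k) j)" for j
  have "e k < n" for k using e dn by (auto simp: bij_betw_def dest: less_le_trans)
  then have "sqrt (lam (e k)) * sqrt (lam (e k)) = lam (e k)" for k
    using lam by simp
  then have Vz: "spectral_embedding e lam u i \<bullet> spectral_embedding e lam u j = ?V i \<bullet> z j" for i j
    unfolding spectral_embedding_def leading_eigenvectors_def z_def inner_vec_def
    by (intro sum.cong refl) (simp add: mult_ac)
  have "\<sigma>\<^sup>2 * (\<Sum>i<n. \<Sum>j<n. (?V i \<bullet> ?V j - U i \<bullet> U j)\<^sup>2) \<le>
      2 * (\<Sum>i<n. \<Sum>j<n. (?V i \<bullet> z j - U i \<bullet> (\<chi> l. t $ l * U j $ l))\<^sup>2)"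
    using sigma_pos by (intro sin_theta_bound[OF orthonormal_U V t]) simp
  also have "\<dots> \<le> 8 * err"
    using embedding_gram_error by (simp add: Vz Xt)
  finally have proj: "(\<Sum>i<n. \<Sum>j<n. (?V i \<bullet> ?V j - U i \<bullet> U j)\<^sup>2) \<le> 8 * err / \<sigma>\<^sup>2"
    using sigma_pos by (simp add: field_simps)
  have "procrustes_sq n ?V U \<le> 5 / (4 * 1) * (\<Sum>i<n. \<Sum>j<n. (?V i \<bullet> ?V j - U i \<bullet> U j)\<^sup>2)"
    by (rule procrustes_sq_le) (simp_all add: orthonormal_sum_inner[OF orthonormal_U] power2_eq_square)
  also have "\<dots> \<le> 5 / (4 * 1) * (8 * err / \<sigma>\<^sup>2)"
    by (intro mult_left_mono proj) simp
  finally show ?thesis by simp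
qed

end

section \<open>Least eigenvalues and limits of Gram matrices\<close>

text \<open>
  Eigenvectors for different eigenvalues are orthogonal, so there can be only finitely many.  This is
  what makes the minimum of the set of eigenvalues meaningful.
\<close>

lemma eigenvalues_finite:
  fixes A :: "real^'d^'d"
  assumes sym: "transpose A = A"
  shows "finite (eigenvalues A)"
proof -
  obtain w where w: "\<And>l. l \<in> eigenvalues A \<Longrightarrow> w l \<noteq> 0 \<and> A *v w l = l *\<^sub>R w l"
    using bchoice[of "eigenvalues A" "\<lambda>l v. v \<noteq> 0 \<and> A *v v = l *\<^sub>R v"]
    unfolding eigenvalues_def by auto
  have orth: "w l \<bullet> w m = 0" if "l \<in> eigenvalues A" "m \<in> eigenvalues A" "l \<noteq> m" for l m
  proof -
    have "l * (w l \<bullet> w m) = (A *v w l) \<bullet> w m"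
      using w[OF that(1)] by simp
    also have "\<dots> = w l \<bullet> (A *v w m)"
      by (metis dot_lmul_matrix sym transpose_matrix_vector)
    also have "\<dots> = m * (w l \<bullet> w m)"
      using w[OF that(2)] by simp
    finally show ?thesis using that(3) by simp
  qed
  have "inj_on w (eigenvalues A)"
    using orth w by (metis inj_onI inner_eq_zero_iff)
  moreover have "finite (w ` eigenvalues A)"
  proof (rule pairwise_orthogonal_imp_finite)
    show "pairwise orthogonal (w ` eigenvalues A)"
      using orth by (auto simp: pairwise_def orthogonal_def)
  qed
  ultimately show ?thesis by (rule finite_imageD[rotated])
qed

text \<open>
  A minimiser of the quadratic form on the unit sphere is an eigenvector, because the first
  variation vanishes there; the minimum value is below every other eigenvalue.
\<close>

lemma smallest_eigenvalue_le_quadratic_form: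
  fixes A :: "real^'d^'d"
  assumes sym: "transpose A = A"
  shows "smallest_eigenvalue A * (v \<bullet> v) \<le> v \<bullet> (A *v v)"
    and "smallest_eigenvalue A \<in> eigenvalues A"
proof -
  let ?S = "sphere (0 :: real^'d) 1"
  have "?S \<noteq> {}" by (metis sphere_eq_empty not_one_less_zero norm_axis_1 mem_sphere_0 empty_iff)
  moreover have "continuous_on ?S (\<lambda>v. v \<bullet> (A *v v))"
    by (intro continuous_intros)
  ultimately obtain v0 where v0: "norm v0 = 1"
    and min: "\<And>v. norm v = 1 \<Longrightarrow> v0 \<bullet> (A *v v0) \<le> v \<bullet> (A *v v)"
    using continuous_attains_inf[of ?S "\<lambda>v. v \<bullet> (A *v v)"] by auto
  define m where "m = v0 \<bullet> (A *v v0)"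
  have quad: "m * (v \<bullet> v) \<le> v \<bullet> (A *v v)" for v
  proof (cases "v = 0")
    case False
    then have "m \<le> (v /\<^sub>R norm v) \<bullet> (A *v (v /\<^sub>R norm v))"
      unfolding m_def by (intro min) simp
    also have "\<dots> = v \<bullet> (A *v v) / (v \<bullet> v)"
      by (simp add: matrix_vector_mult_scaleR divide_inverse dot_square_norm power2_eq_square)
    finally show ?thesis using False by (simp add: field_simps)
  qed simp
  have "w \<bullet> (A *v v0 - m *\<^sub>R v0) = 0" for w
  proof -
    have Aw: "v0 \<bullet> (A *v w) = w \<bullet> (A *v v0)"
      by (metis dot_lmul_matrix inner_commute sym transpose_matrix_vector)
    have "t * (- 2 * (w \<bullet> (A *v v0 - m *\<^sub>R v0))) \<le> t\<^sup>2 * (w \<bullet> (A *v w) - m * (w \<bullet> w))" for t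
    proof -
      have vv: "v0 \<bullet> v0 = 1" using v0 by (simp add: dot_square_norm)
      have "m * ((v0 + t *\<^sub>R w) \<bullet> (v0 + t *\<^sub>R w)) \<le> (v0 + t *\<^sub>R w) \<bullet> (A *v (v0 + t *\<^sub>R w))"
        by (rule quad)
      also have "\<dots> = m + 2 * t * (w \<bullet> (A *v v0)) + t\<^sup>2 * (w \<bullet> (A *v w))"
        by (simp add: m_def matrix_vector_right_distrib matrix_vector_mult_scaleR
            inner_add_left inner_add_right Aw power2_eq_square algebra_simps)
      also have "(v0 + t *\<^sub>R w) \<bullet> (v0 + t *\<^sub>R w) = 1 + 2 * t * (w \<bullet> v0) + t\<^sup>2 * (w \<bullet> w)"
        by (simp add: inner_add_left inner_add_right vv inner_commute[of v0 w] power2_eq_square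
            algebra_simps)
      finally show ?thesis by (simp add: inner_diff_right algebra_simps)
    qed
    then show ?thesis using quadratic_nonpos_imp_linear_coeff_zero by fastforce
  qed
  then have "A *v v0 = m *\<^sub>R v0" by (metis inner_eq_zero_iff right_minus_eq)
  then have m_eig: "m \<in> eigenvalues A"
    using v0 by (auto simp: eigenvalues_def intro!: exI[of _ v0])
  have "m \<le> l" if "l \<in> eigenvalues A" for l
  proof -
    from that obtain v where "v \<noteq> 0" "A *v v = l *\<^sub>R v" by (auto simp: eigenvalues_def)
    then show ?thesis using quad[of v] by simp
  qed
  then have "smallest_eigenvalue A = m"
    unfolding smallest_eigenvalue_def by (intro Min_eqI eigenvalues_finite sym m_eig)
  then show "smallest_eigenvalue A * (v \<bullet> v) \<le> v \<bullet> (A *v v)"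
    and "smallest_eigenvalue A \<in> eigenvalues A"
    using quad m_eig by simp_all
qed

lemma smallest_eigenvalue_pos:
  assumes "positive_definite A" shows "0 < smallest_eigenvalue A"
proof -
  obtain v where "v \<noteq> 0" "A *v v = smallest_eigenvalue A *\<^sub>R v"
    using smallest_eigenvalue_le_quadratic_form(2)[of A] assms
    by (auto simp: eigenvalues_def positive_definite_def)
  moreover from this have "0 < v \<bullet> (A *v v)" using assms unfolding positive_definite_def by blast
  ultimately have "0 < smallest_eigenvalue A * (v \<bullet> v)" by simp
  then show ?thesis using \<open>v \<noteq> 0\<close> zero_less_mult_pos2 inner_gt_zero_iff by blast
qed

lemma norm_matrix_vector_mult_le: "norm (A *v x) \<le> norm A * norm (x :: real^'n)"
proof -
  have "norm (A *v x) = L2_set (\<lambda>i. norm (A $ i \<bullet> x)) UNIV"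
    by (simp add: norm_vec_def matrix_vector_mul_component)
  also have "\<dots> \<le> L2_set (\<lambda>i. norm (A $ i) * norm x) UNIV"
    by (intro L2_set_mono) (auto simp: Cauchy_Schwarz_ineq2)
  also have "\<dots> = norm A * norm x"
    by (simp add: norm_vec_def[of A] L2_set_left_distrib)
  finally show ?thesis .
qed

lemma gram_limit_lower_bound:
  fixes X :: "nat \<Rightarrow> nat \<Rightarrow> real^'d"
  assumes lim: "(\<lambda>n. (1 / real n) *\<^sub>R gram_matrix n (X n)) \<longlonglongrightarrow> \<Delta>"
    and pd: "positive_definite \<Delta>" and c: "c < smallest_eigenvalue \<Delta>"
  shows "\<forall>\<^sub>F n in sequentially. \<forall>v. (c * real n) * (v \<bullet> v) \<le> (\<Sum>i<n. (X n i \<bullet> v)\<^sup>2)"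
proof -
  have "\<forall>\<^sub>F n in sequentially.
      dist ((1 / real n) *\<^sub>R gram_matrix n (X n)) \<Delta> < smallest_eigenvalue \<Delta> - c"
    using lim c by (intro tendstoD) auto
  with eventually_gt_at_top[of 0] show ?thesis
  proof eventually_elim
    case (elim n)
    define G where "G = (1 / real n) *\<^sub>R gram_matrix n (X n)"
    have "c * real n * (v \<bullet> v) \<le> (\<Sum>i<n. (X n i \<bullet> v)\<^sup>2)" for v
    proof -
      have "- (v \<bullet> ((G - \<Delta>) *v v)) \<le> norm v * norm ((G - \<Delta>) *v v)"
        using Cauchy_Schwarz_ineq2[of v "(G - \<Delta>) *v v"] by linarith
      also have "\<dots> \<le> norm v * (norm (G - \<Delta>) * norm v)"
        by (intro mult_left_mono norm_matrix_vector_mult_le) simp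
      also have "\<dots> = norm (G - \<Delta>) * (v \<bullet> v)"
        by (simp add: dot_square_norm power2_eq_square)
      also have "\<dots> \<le> (smallest_eigenvalue \<Delta> - c) * (v \<bullet> v)"
        using elim by (intro mult_right_mono) (auto simp: G_def dist_norm)
      finally have "c * (v \<bullet> v) \<le> v \<bullet> (G *v v)"
        using smallest_eigenvalue_le_quadratic_form(1)[of \<Delta> v] pd
        by (simp add: positive_definite_def matrix_vector_mult_diff_rdistrib inner_diff_right algebra_simps)
      also have "v \<bullet> (G *v v) = (\<Sum>i<n. (X n i \<bullet> v)\<^sup>2) / real n"
        unfolding G_def scaleR_matrix_vector_assoc[symmetric]
        by (simp add: inner_gram_matrix power2_eq_square)
      finally show ?thesis using elim by (simp add: field_simps)
    qed
    then show ?case by blast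
  qed
qed

section \<open>Posterior and posterior mean\<close>

text \<open>
  Jensen's inequality for the square, read off from the variance of f - c.
\<close>

lemma (in prob_space) square_expectation_diff_le:
  fixes f :: "'a \<Rightarrow> real"
  assumes [measurable]: "f \<in> borel_measurable M" and bound: "AE x in M. \<bar>f x\<bar> \<le> B"
  shows "(expectation f - c)\<^sup>2 \<le> expectation (\<lambda>x. (f x - c)\<^sup>2)"
proof -
  have f: "integrable M f"
    using bound by (intro integrable_const_bound[of _ B]) auto
  then have g: "integrable M (\<lambda>x. f x - c)" by simp
  have g2: "integrable M (\<lambda>x. (f x - c)\<^sup>2)"
  proof (rule integrable_const_bound)
    show "AE x in M. norm ((f x - c)\<^sup>2) \<le> (B + \<bar>c\<bar>)\<^sup>2"
      using bound
    proof eventually_elim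
      case (elim x)
      then have "\<bar>f x - c\<bar>\<^sup>2 \<le> (B + \<bar>c\<bar>)\<^sup>2" by (intro power_mono) auto
      then show ?case by simp
    qed
  qed simp
  have "0 \<le> variance (\<lambda>x. f x - c)" by (rule variance_positive)
  also have "\<dots> = expectation (\<lambda>x. (f x - c)\<^sup>2) - (expectation (\<lambda>x. f x - c))\<^sup>2"
    by (rule variance_eq[OF g g2])
  also have "expectation (\<lambda>x. f x - c) = expectation f - c"
    using f by (simp add: prob_space)
  finally show ?thesis by simp
qed

lemma integral_double_sum:
  fixes f :: "'i \<Rightarrow> 'j \<Rightarrow> 'a \<Rightarrow> real"
  assumes f: "\<And>i j. i \<in> I \<Longrightarrow> j \<in> J \<Longrightarrow> integrable M (f i j)"
  shows "(\<integral>x. (\<Sum>i\<in>I. \<Sum>j\<in>J. f i j x) \<partial>M) = (\<Sum>i\<in>I. \<Sum>j\<in>J. \<integral>x. f i j x \<partial>M)"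
proof -
  have "(\<integral>x. (\<Sum>i\<in>I. \<Sum>j\<in>J. f i j x) \<partial>M) = (\<Sum>i\<in>I. \<integral>x. (\<Sum>j\<in>J. f i j x) \<partial>M)"
    by (intro Bochner_Integration.integral_sum Bochner_Integration.integrable_sum f)
  also have "\<dots> = (\<Sum>i\<in>I. \<Sum>j\<in>J. \<integral>x. f i j x \<partial>M)"
    by (intro sum.cong refl Bochner_Integration.integral_sum f)
  finally show ?thesis .
qed

lemma edge_prob_latent:
  assumes "x \<in> latent_space" "y \<in> latent_space"
  shows "0 \<le> x \<bullet> y" "x \<bullet> y \<le> 1"
proof -
  show "0 \<le> x \<bullet> y" using assms by (auto simp: latent_space_def inner_vec_def intro!: sum_nonneg)
  have "x \<bullet> y \<le> norm x * norm y" by (rule norm_cauchy_schwarz)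
  also have "\<dots> \<le> 1" using assms by (auto simp: latent_space_def intro!: mult_le_one)
  finally show "x \<bullet> y \<le> 1" .
qed

lemma edge_lik_pos: "0 < edge_prob X i j \<Longrightarrow> edge_prob X i j < 1 \<Longrightarrow> 0 < edge_lik X Y i j"
  by (simp add: edge_lik_def)

lemma edge_lik_bounds:
  assumes "0 \<le> edge_prob X i j" "edge_prob X i j \<le> 1"
  shows "0 \<le> edge_lik X Y i j" "edge_lik X Y i j \<le> 1"
  using assms unfolding edge_lik_def by (auto intro!: mult_le_one power_le_one)

locale rdpg_posterior =
  fixes n :: nat and X0 :: "nat \<Rightarrow> real^'d" and \<pi> :: "real^'d \<Rightarrow> real" and a :: real
  assumes pi_measurable [measurable]: "\<pi> \<in> borel_measurable borel"
    and pi_density: "prob_space (density lborel (\<lambda>x. ennreal (\<pi> x)))"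
    and a_pos: "0 < a" and pi_lower: "\<And>x. x \<in> latent_space \<Longrightarrow> a \<le> \<pi> x"
    and X0_pos: "\<And>i j. i < n \<Longrightarrow> j < n \<Longrightarrow> 0 < X0 i \<bullet> X0 j"
    and X0_less_1: "\<And>i j. i < n \<Longrightarrow> j < n \<Longrightarrow> X0 i \<bullet> X0 j < 1"
begin

abbreviation "pairs \<equiv> {(i :: nat, j). i \<le> j \<and> j < n}"

lemma edge_lik_X0_pos: "(i, j) \<in> pairs \<Longrightarrow> 0 < edge_lik X0 Y i j"
  by (intro edge_lik_pos) (auto simp: edge_prob_def X0_pos X0_less_1)

lemma edge_prob_latent_matrices:
  assumes "X \<in> latent_matrices n" "i < n" "j < n"
  shows "0 \<le> edge_prob X i j" "edge_prob X i j \<le> 1"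
  using assms edge_prob_latent[of "X i" "X j"]
  by (auto simp: latent_matrices_def edge_prob_def)

lemma lik_ratio_le:
  assumes "X \<in> latent_matrices n"
  shows "lik_ratio n X0 Y X \<le> (\<Prod>(i, j)\<in>pairs. 1 / edge_lik X0 Y i j)"
  unfolding lik_ratio_def
proof (rule prod_mono, clarify)
  fix i j assume ij: "i \<le> j" "j < n"
  then have "0 < edge_lik X0 Y i j" "0 \<le> edge_lik X Y i j" "edge_lik X Y i j \<le> 1"
    using edge_lik_X0_pos edge_lik_bounds[OF edge_prob_latent_matrices[OF assms]] by auto
  then show "0 \<le> edge_lik X Y i j / edge_lik X0 Y i j \<and>
      edge_lik X Y i j / edge_lik X0 Y i j \<le> 1 / edge_lik X0 Y i j"
    by (simp add: divide_right_mono)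
qed

lemma lik_ratio_pos:
  assumes "\<And>i j. i < n \<Longrightarrow> j < n \<Longrightarrow> 0 < X i \<bullet> X j \<and> X i \<bullet> X j < 1"
  shows "0 < lik_ratio n X0 Y X"
  unfolding lik_ratio_def
  using assms by (intro prod_pos)
    (auto intro!: divide_pos_pos edge_lik_X0_pos edge_lik_pos[of X] simp: edge_prob_def)

lemma prob_space_prior: "prob_space (prior n \<pi>)"
  unfolding prior_def by (intro prob_space_PiM pi_density)

text \<open>
  A set of positive prior mass on which all edge probabilities lie strictly between 0 and 1: the side
  1/d keeps the norm below 1, and open sides keep all coordinates positive.  On it the likelihood cannot
  vanish, which is how the evidence is seen to be positive.
\<close>

definition cube :: "(real^'d) set" where
  "cube = box 0 (\<chi> k. 1 / real CARD('d))"

lemma cube_iff: "x \<in> cube \<longleftrightarrow> (\<forall>k. 0 < x $ k \<and> x $ k < 1 / real CARD('d))"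
  by (auto simp: cube_def mem_box_cart)

lemma cube_norm:
  assumes "x \<in> cube" shows "norm x < 1"
proof -
  have "norm x \<le> (\<Sum>k\<in>UNIV. \<bar>x $ k\<bar>)" by (rule norm_le_l1_cart)
  also have "\<dots> < (\<Sum>k\<in>(UNIV :: 'd set). 1 / real CARD('d))"
    using assms by (intro sum_strict_mono) (auto simp: cube_iff abs_of_pos)
  finally show ?thesis by simp
qed

lemma cube_latent: "cube \<subseteq> latent_space"
  using cube_norm by (force simp: latent_space_def cube_iff intro: less_imp_le)

lemma cube_prior_pos: "0 < emeasure (density lborel (\<lambda>x. ennreal (\<pi> x))) cube"
proof -
  have "0 < ennreal a * emeasure lborel cube"
    using a_pos by (auto simp: cube_def emeasure_lborel_box_eq Basis_vec_def inner_axis ennreal_zero_less_mult_iff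
        intro!: prod_pos)
  also have "\<dots> = (\<integral>\<^sup>+x. ennreal a * indicator cube x \<partial>lborel)"
    by (simp add: cube_def nn_integral_cmult_indicator)
  also have "\<dots> \<le> (\<integral>\<^sup>+x. ennreal (\<pi> x) * indicator cube x \<partial>lborel)"
    using pi_lower cube_latent by (intro nn_integral_mono) (auto simp: indicator_def intro!: ennreal_leI)
  also have "\<dots> = emeasure (density lborel (\<lambda>x. ennreal (\<pi> x))) cube"
    by (subst emeasure_density) (auto simp: cube_def)
  finally show ?thesis .
qed

lemma cubes_prior_pos: "0 < emeasure (prior n \<pi>) (\<Pi>\<^sub>E i\<in>{..<n}. cube)"
proof -
  interpret product_prob_space "\<lambda>_ :: nat. density lborel (\<lambda>x. ennreal (\<pi> x))"
    by (simp add: product_prob_space_def product_prob_space_axioms_def product_sigma_finite_def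
        pi_density prob_space_imp_sigma_finite)
  have "emeasure (prior n \<pi>) (\<Pi>\<^sub>E i\<in>{..<n}. cube) =
    (\<Prod>i<n. emeasure (density lborel (\<lambda>x. ennreal (\<pi> x))) cube)"
    unfolding prior_def by (intro emeasure_PiM) (auto simp: cube_def)
  moreover have "emeasure (density lborel (\<lambda>x. ennreal (\<pi> x))) cube \<noteq> 0"
    using cube_prior_pos by simp
  ultimately have "emeasure (prior n \<pi>) (\<Pi>\<^sub>E i\<in>{..<n}. cube) \<noteq> 0"
    by simp
  then show ?thesis by (rule zero_less_iff_neq_zero[THEN iffD2])
qed

lemma evidence_finite: "evidence n X0 \<pi> Y (latent_matrices n) < \<infinity>"
proof -
  interpret prior: prob_space "prior n \<pi>" by (rule prob_space_prior)
  have "evidence n X0 \<pi> Y (latent_matrices n) \<le>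
      (\<integral>\<^sup>+X. ennreal (\<Prod>(i, j)\<in>pairs. 1 / edge_lik X0 Y i j) \<partial>prior n \<pi>)"
    unfolding evidence_def using lik_ratio_le
    by (intro nn_integral_mono) (auto simp: indicator_def intro!: ennreal_leI)
  also have "\<dots> < \<infinity>" by (simp add: prior.emeasure_space_1)
  finally show ?thesis .
qed

lemma evidence_pos: "0 < evidence n X0 \<pi> Y (latent_matrices n)"
proof (rule ccontr)
  assume "\<not> ?thesis"
  then have "(\<integral>\<^sup>+X. ennreal (lik_ratio n X0 Y X) * indicator (latent_matrices n) X \<partial>prior n \<pi>) = 0"
    by (simp add: evidence_def)
  then have "AE X in prior n \<pi>. ennreal (lik_ratio n X0 Y X) * indicator (latent_matrices n) X = 0"
    by (subst (asm) nn_integral_0_iff_AE) auto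
  then have "AE X in prior n \<pi>. X \<notin> (\<Pi>\<^sub>E i\<in>{..<n}. cube)"
  proof eventually_elim
    case (elim X)
    show ?case
    proof
      assume X: "X \<in> (\<Pi>\<^sub>E i\<in>{..<n}. cube)"
      have "0 < lik_ratio n X0 Y X"
      proof (rule lik_ratio_pos)
        fix i j assume "i < n" "j < n"
        then have c: "X i \<in> cube" "X j \<in> cube" using X by auto
        have "0 < X i \<bullet> X j"
          using c by (auto simp: inner_vec_def cube_iff intro!: sum_pos)
        moreover have "X i \<bullet> X j < 1"
          using norm_cauchy_schwarz[of "X i" "X j"] cube_norm[OF c(1)] cube_norm[OF c(2)]
          by (smt (verit) mult_left_le_one_le norm_ge_zero)
        ultimately show "0 < X i \<bullet> X j \<and> X i \<bullet> X j < 1" by simp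
      qed
      moreover have "X \<in> latent_matrices n"
        using X cube_latent by (auto simp: latent_matrices_def)
      ultimately show False using elim by simp
    qed
  qed
  moreover have "(\<Pi>\<^sub>E i\<in>{..<n}. cube) \<in> sets (prior n \<pi>)"
    unfolding sets_prior by (intro sets_PiM_I_finite) (auto simp: cube_def)
  ultimately have "emeasure (prior n \<pi>) (\<Pi>\<^sub>E i\<in>{..<n}. cube) = 0"
    by (subst (asm) AE_iff_measurable[OF _ refl]) (auto dest: sets.sets_into_space
      intro!: arg_cong[where f = "emeasure (prior n \<pi>)"] elim!: back_subst[where P="\<lambda>x. x = 0"])
  then show False using cubes_prior_pos by simp
qed

lemma sets_posterior: "sets (posterior n X0 \<pi> Y) = sets (prior n \<pi>)"
  by (simp add: posterior_def)

lemma prob_space_posterior: "prob_space (posterior n X0 \<pi> Y)"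
proof
  have "emeasure (posterior n X0 \<pi> Y) (space (posterior n X0 \<pi> Y)) =
    (\<integral>\<^sup>+X. ennreal (lik_ratio n X0 Y X) * indicator (latent_matrices n) X
        / evidence n X0 \<pi> Y (latent_matrices n) \<partial>prior n \<pi>)"
    by (subst posterior_def, subst emeasure_density)
       (auto simp: posterior_def intro!: nn_integral_cong)
  also have "\<dots> = evidence n X0 \<pi> Y (latent_matrices n) / evidence n X0 \<pi> Y (latent_matrices n)"
    unfolding evidence_def by (subst nn_integral_divide) auto
  also have "\<dots> = 1"
    using evidence_pos[of Y] evidence_finite[of Y] by (intro ennreal_divide_self) auto
  finally show "emeasure (posterior n X0 \<pi> Y) (space (posterior n X0 \<pi> Y)) = 1" .
qed

lemma AE_posterior_latent: "AE X in posterior n X0 \<pi> Y. X \<in> latent_matrices n"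
  unfolding posterior_def by (subst AE_density) (auto simp: indicator_def)

lemma measurable_edge_prob:
  assumes "i < n" "j < n"
  shows "(\<lambda>X. edge_prob X i j) \<in> borel_measurable (posterior n X0 \<pi> Y)"
  unfolding edge_prob_def measurable_cong_sets[OF trans[OF sets_posterior sets_prior] refl]
  using assms by (intro borel_measurable_inner measurable_component_singleton) auto

lemma AE_posterior_edge_prob:
  assumes "i < n" "j < n"
  shows "AE X in posterior n X0 \<pi> Y. \<bar>edge_prob X i j\<bar> \<le> 1"
  using AE_posterior_latent
  by eventually_elim (use assms edge_prob_latent_matrices in \<open>simp add: abs_le_iff\<close>, force)

lemma integrable_edge_prob:
  assumes "i < n" "j < n"
  shows "integrable (posterior n X0 \<pi> Y) (\<lambda>X. edge_prob X i j)"
proof -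
  interpret prob_space "posterior n X0 \<pi> Y" by (rule prob_space_posterior)
  show ?thesis
    using AE_posterior_edge_prob[OF assms] measurable_edge_prob[OF assms]
    by (intro integrable_const_bound[of _ 1]) auto
qed

lemma posterior_mean_psd:
  "0 \<le> (\<Sum>i<n. \<Sum>j<n. v i * posterior_mean n X0 \<pi> Y i j * v j)"
proof -
  have "(\<Sum>i<n. \<Sum>j<n. v i * posterior_mean n X0 \<pi> Y i j * v j) =
    (\<integral>X. (\<Sum>i<n. \<Sum>j<n. v i * edge_prob X i j * v j) \<partial>posterior n X0 \<pi> Y)"
  proof -
    have "integrable (posterior n X0 \<pi> Y) (\<lambda>X. v i * edge_prob X i j * v j)"
      if "i < n" "j < n" for i j
      using integrable_edge_prob[OF that] by (intro integrable_mult_left integrable_mult_right)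
    then show ?thesis
      by (subst integral_double_sum) (simp_all add: posterior_mean_def integrable_edge_prob)
  qed
  also have "\<dots> = (\<integral>X. (\<Sum>i<n. v i *\<^sub>R X i) \<bullet> (\<Sum>i<n. v i *\<^sub>R X i) \<partial>posterior n X0 \<pi> Y)"
    by (simp add: edge_prob_def inner_sum_left inner_sum_right sum_distrib_left mult_ac,
        intro Bochner_Integration.integral_cong sum.cong refl, simp add: inner_commute)
  also have "\<dots> \<ge> 0" by (intro Bochner_Integration.integral_nonneg) simp
  finally show ?thesis .
qed

text \<open>
  An eigenvalue is the quadratic form of the posterior mean at its eigenvector.  Nonnegativity
  matters because the embedding takes square roots and the truncation keeps the largest eigenvalues,
  which are then also the largest in absolute value.
\<close>

lemma posterior_mean_eigenvalue_nonneg: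
  assumes sd: "spectral_decomposition n (posterior_mean n X0 \<pi> Y) lam u" and k: "k < n"
  shows "0 \<le> lam k"
proof -
  have on: "(\<Sum>i<n. u j i * u k i) = (if j = k then 1 else 0)" if "j < n" for j
    using sd k that by (simp add: spectral_decomposition_def)
  have "(\<Sum>i<n. \<Sum>j<n. u k i * posterior_mean n X0 \<pi> Y i j * u k j) =
    (\<Sum>i<n. \<Sum>j<n. \<Sum>l<n. lam l * (u l i * u k i) * (u l j * u k j))"
    using sd by (simp add: spectral_decomposition_def sum_distrib_left sum_distrib_right mult_ac)
  also have "\<dots> = (\<Sum>i<n. \<Sum>l<n. \<Sum>j<n. lam l * (u l i * u k i) * (u l j * u k j))"
    by (intro sum.cong refl sum.swap)
  also have "\<dots> = (\<Sum>l<n. \<Sum>i<n. \<Sum>j<n. lam l * (u l i * u k i) * (u l j * u k j))"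
    by (rule sum.swap)
  also have "\<dots> = (\<Sum>l<n. lam l * (\<Sum>i<n. u l i * u k i) * (\<Sum>j<n. u l j * u k j))"
    by (simp add: sum_distrib_left sum_distrib_right mult_ac)
  also have "\<dots> = (\<Sum>l<n. if l = k then lam k else 0)"
    by (intro sum.cong refl) (simp add: on)
  also have "\<dots> = lam k" using k by simp
  finally show ?thesis using posterior_mean_psd[of "u k" Y] by simp
qed

definition far :: "real \<Rightarrow> (nat \<Rightarrow> real^'d) set" where
  "far r = {X \<in> latent_matrices n.
     1 / real n * frobenius_norm {..<n} {..<n} (\<lambda>i j. edge_prob X i j - edge_prob X0 i j) > r / sqrt (real n)}"

lemma far_measurable: "far r \<in> sets (posterior n X0 \<pi> Y)"
proof -
  have 1: "(\<lambda>X. (edge_prob X i j - edge_prob X0 i j)\<^sup>2) \<in> borel_measurable (posterior n X0 \<pi> Y)"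
    if "i \<in> {..<n}" "j \<in> {..<n}" for i j
    using that by (intro borel_measurable_power borel_measurable_diff measurable_edge_prob) auto
  have 2: "(\<lambda>X. \<Sum>i<n. \<Sum>j<n. (edge_prob X i j - edge_prob X0 i j)\<^sup>2)
      \<in> borel_measurable (posterior n X0 \<pi> Y)"
    by (intro borel_measurable_sum 1)
  have [measurable]: "(\<lambda>X. frobenius_norm {..<n} {..<n} (\<lambda>i j. edge_prob X i j - edge_prob X0 i j))
      \<in> borel_measurable (posterior n X0 \<pi> Y)"
    unfolding frobenius_norm_def using 2 by measurable
  have [measurable]: "latent_matrices n \<in> sets (posterior n X0 \<pi> Y)"
    by (simp add: sets_posterior sets_latent_matrices)
  have "far r = latent_matrices n \<inter> {X \<in> space (posterior n X0 \<pi> Y).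
      1 / real n * frobenius_norm {..<n} {..<n} (\<lambda>i j. edge_prob X i j - edge_prob X0 i j) > r / sqrt (real n)}"
    using sets.sets_into_space[of "latent_matrices n" "posterior n X0 \<pi> Y"]
    by (auto simp: far_def)
  then show ?thesis by simp
qed

text \<open>
  By Jensen's inequality, the squared error of the posterior mean is at most the posterior mean of the
  squared error.  That is at most r^2 n where the normalised distance is at most r divided by the root of n, and never more than n^2, as all entries are
  probabilities.
\<close>

lemma posterior_mean_error:
  assumes n: "0 < n" and r: "0 \<le> r"
  shows "(\<Sum>i<n. \<Sum>j<n. (posterior_mean n X0 \<pi> Y i j - X0 i \<bullet> X0 j)\<^sup>2) \<le>
    r\<^sup>2 * real n + (real n)\<^sup>2 * measure (posterior n X0 \<pi> Y) (far r)"
proof -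
  interpret prob_space "posterior n X0 \<pi> Y" by (rule prob_space_posterior)
  define F where "F X = (\<Sum>i<n. \<Sum>j<n. (edge_prob X i j - X0 i \<bullet> X0 j)\<^sup>2)"
    for X :: "nat \<Rightarrow> real^'d"
  have small: "(edge_prob X i j - X0 i \<bullet> X0 j)\<^sup>2 \<le> 1" if "X \<in> latent_matrices n" "i < n" "j < n" for X i j
  proof -
    have "\<bar>edge_prob X i j - X0 i \<bullet> X0 j\<bar> \<le> 1"
      using edge_prob_latent_matrices[OF that] X0_pos[OF that(2,3)] X0_less_1[OF that(2,3)] by linarith
    then show ?thesis by (simp add: abs_square_le_1)
  qed
  have int: "integrable (posterior n X0 \<pi> Y) (\<lambda>X. (edge_prob X i j - X0 i \<bullet> X0 j)\<^sup>2)"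
    if "i < n" "j < n" for i j
  proof (rule integrable_const_bound)
    show "AE X in posterior n X0 \<pi> Y. norm ((edge_prob X i j - X0 i \<bullet> X0 j)\<^sup>2) \<le> 1"
      using AE_posterior_latent by eventually_elim (use small that in simp)
  qed (intro borel_measurable_power borel_measurable_diff measurable_edge_prob that, simp)
  have "(\<Sum>i<n. \<Sum>j<n. (posterior_mean n X0 \<pi> Y i j - X0 i \<bullet> X0 j)\<^sup>2) \<le>
    (\<Sum>i<n. \<Sum>j<n. expectation (\<lambda>X. (edge_prob X i j - X0 i \<bullet> X0 j)\<^sup>2))"
    unfolding posterior_mean_def
    by (intro sum_mono square_expectation_diff_le[of _ 1] measurable_edge_prob AE_posterior_edge_prob) auto
  also have "\<dots> = expectation F"
    unfolding F_def by (subst integral_double_sum) (simp_all add: int)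
  also have "\<dots> \<le> expectation (\<lambda>X. r\<^sup>2 * real n + (real n)\<^sup>2 * indicator (far r) X)"
  proof (rule integral_mono_AE)
    show "integrable (posterior n X0 \<pi> Y) F"
      unfolding F_def by (intro Bochner_Integration.integrable_sum int) auto
    show "integrable (posterior n X0 \<pi> Y) (\<lambda>X. r\<^sup>2 * real n + (real n)\<^sup>2 * indicator (far r) X)"
      using far_measurable[of r Y] by (simp add: emeasure_eq_measure)
    show "AE X in posterior n X0 \<pi> Y. F X \<le> r\<^sup>2 * real n + (real n)\<^sup>2 * indicator (far r) X"
      using AE_posterior_latent
    proof eventually_elim
      case (elim X)
      have F0: "0 \<le> F X" unfolding F_def by (intro sum_nonneg) simp
      show ?case
      proof (cases "X \<in> far r")
        case True
        have "F X \<le> (\<Sum>i<n. \<Sum>j<n. 1)"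
          unfolding F_def by (intro sum_mono small elim) auto
        then have "F X \<le> (real n)\<^sup>2" by (simp add: power2_eq_square)
        then show ?thesis using True by (simp add: add_increasing)
      next
        case False
        then have "1 / real n * sqrt (F X) \<le> r / sqrt (real n)"
          using elim by (simp add: far_def F_def frobenius_norm_def edge_prob_def not_less)
        then have "sqrt (F X) \<le> r / sqrt (real n) * real n"
          using n by (simp add: field_simps)
        also have "\<dots> = r * sqrt (real n)"
          using n by (simp add: field_simps)
        finally have "(sqrt (F X))\<^sup>2 \<le> (r * sqrt (real n))\<^sup>2"
          using F0 by (intro power_mono) auto
        then show ?thesis using False F0 by (simp add: power_mult_distrib)
      qed
    qed
  qed
  also have "\<dots> = r\<^sup>2 * real n + (real n)\<^sup>2 * prob (far r)"
    using far_measurable[of r Y] by (simp add: emeasure_eq_measure prob_space)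
  finally show ?thesis .
qed

end

section \<open>Recovery of the latent positions\<close>

text \<open>
  There are only finitely many graphs on n vertices, so every function of the graph is integrable.
\<close>

lemma finite_set_pmf_rdpg: "finite (set_pmf (rdpg n X))"
proof -
  have pairs: "finite {(i, j :: nat). i \<le> j \<and> j < n}"
    by (rule finite_subset[of _ "{..<n} \<times> {..<n}"]) auto
  have "finite (PiE_dflt {(i, j :: nat). i \<le> j \<and> j < n} False (\<lambda>_. UNIV :: bool set))"
    by (intro finite_PiE_dflt pairs) simp
  then have "finite (set_pmf (Pi_pmf {(i, j). i \<le> j \<and> j < n} False (\<lambda>(i, j). bernoulli_pmf (edge_prob X i j))))"
    by (rule finite_subset[rotated]) (use set_Pi_pmf_subset'[OF pairs] in \<open>force simp: PiE_dflt_def\<close>)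
  then show ?thesis by (simp add: rdpg_def)
qed

text \<open>
  The left-hand side is what Markov's inequality gives at the level 3 M^2 / n for a variable whose mean
  is exponentially small in n; the claim only asks for a rate in the root of n.
\<close>

lemma tail_bound_eventually:
  fixes M d :: real
  assumes "0 < M" "0 < d"
  shows "\<forall>\<^sub>F n in sequentially. real n / (3 * M\<^sup>2) * (8 * exp (- (1 / 2) * real n * d))
    \<le> 2 * exp (- (1 / 4) * M * d * sqrt (real n))"
  using assms by real_asymp

theorem theorem4:
  fixes X0 :: "nat \<Rightarrow> nat \<Rightarrow> real^'d"
    and \<pi> :: "real^'d \<Rightarrow> real"
    and \<Delta> :: "real^'d^'d"
    and \<delta> M\<^sub>1 :: real
    and e :: "'d \<Rightarrow> nat"
    and lam :: "nat \<Rightarrow> (nat \<Rightarrow> nat \<Rightarrow> nat) \<Rightarrow> nat \<Rightarrow> real"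
    and u :: "nat \<Rightarrow> (nat \<Rightarrow> nat \<Rightarrow> nat) \<Rightarrow> nat \<Rightarrow> nat \<Rightarrow> real"
    and U0 :: "nat \<Rightarrow> nat \<Rightarrow> real^'d"
  assumes X0_rows: "\<And>n i. i < n \<Longrightarrow> X0 n i \<in> latent_space"
    and pi_measurable: "\<pi> \<in> borel_measurable borel"
    and pi_density: "prob_space (density lborel (\<lambda>x. ennreal (\<pi> x)))"
    and pi_support: "\<And>x. x \<notin> latent_space \<Longrightarrow> \<pi> x = 0"
    and pi_bounds: "\<exists>a b. 0 < a \<and> (\<forall>x\<in>latent_space. a \<le> \<pi> x \<and> \<pi> x \<le> b)"
    and Delta_pd: "positive_definite \<Delta>"
    and Delta_limit: "(\<lambda>n. (1 / real n) *\<^sub>R gram_matrix n (X0 n)) \<longlonglongrightarrow> \<Delta>"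
    and delta: "0 < \<delta>" "\<delta> < 1 / 2"
    and X0_delta: "\<And>n i j. i < n \<Longrightarrow> j < n \<Longrightarrow> \<delta> \<le> X0 n i \<bullet> X0 n j \<and> X0 n i \<bullet> X0 n j \<le> 1 - \<delta>"
    and M1_pos: "0 < M\<^sub>1"
    and contraction:
      "\<forall>\<^sub>F n in sequentially.
         measure_pmf.expectation (rdpg n (X0 n))
           (\<lambda>Y. measure (posterior n (X0 n) \<pi> Y)
              {X \<in> latent_matrices n.
                 1 / real n * frobenius_norm {..<n} {..<n}
                   (\<lambda>i j. edge_prob X i j - edge_prob (X0 n) i j) > M\<^sub>1 / sqrt (real n)})
         \<le> 8 * exp (- (1 / 2) * real n * real CARD('d))"
    and e_bij: "bij_betw e UNIV {..<CARD('d)}"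
    and spectral:
      "\<And>n Y. Y \<in> set_pmf (rdpg n (X0 n)) \<Longrightarrow>
         spectral_decomposition n (posterior_mean n (X0 n) \<pi> Y) (lam n Y) (u n Y)"
    and U0_svd: "\<And>n. CARD('d) \<le> n \<Longrightarrow> left_singular_vectors n (X0 n) (U0 n)"
  shows
    "(\<exists>C>0. \<forall>\<^sub>F n in sequentially.
        measure_pmf.expectation (rdpg n (X0 n))
          (\<lambda>Y. 1 / real n * procrustes_sq n (spectral_embedding e (lam n Y) (u n Y)) (X0 n))
        \<le> C / real n) \<and>
     (\<forall>\<^sub>F n in sequentially.
        measure_pmf.prob (rdpg n (X0 n))
          {Y. procrustes_sq n (leading_eigenvectors e (u n Y)) (U0 n)
              > 128 * M\<^sub>1\<^sup>2 * real CARD('d) / ((smallest_eigenvalue \<Delta>)\<^sup>2 * real n)}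
        \<le> 2 * exp (- (1 / 4) * M\<^sub>1 * real CARD('d) * sqrt (real n)))"
proof -
  obtain a b where a: "0 < a" "\<And>x. x \<in> latent_space \<Longrightarrow> a \<le> \<pi> x"
    using pi_bounds by blast
  have post: "rdpg_posterior n (X0 n) \<pi> a" for n
  proof (rule rdpg_posterior.intro[OF pi_measurable pi_density a])
    fix i j assume "i < n" "j < n"
    then have "\<delta> \<le> X0 n i \<bullet> X0 n j" "X0 n i \<bullet> X0 n j \<le> 1 - \<delta>"
      using X0_delta by blast+
    then show "0 < X0 n i \<bullet> X0 n j" "X0 n i \<bullet> X0 n j < 1"
      using delta by linarith+
  qed
  define \<mu> where "\<mu> = smallest_eigenvalue \<Delta>"
  have mu: "0 < \<mu>"
    unfolding \<mu>_def by (rule smallest_eigenvalue_pos[OF Delta_pd])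
  \<comment> \<open>Any factor below 1 leaves room for the convergence of the Gram matrices; 3/4 is large enough
    for the constant 128 below.\<close>
  define c where "c = 3 / 4 * \<mu>"
  have c: "0 < c" "c < smallest_eigenvalue \<Delta>"
    using mu by (simp_all add: c_def \<mu>_def)
  define p where "p n Y = measure (posterior n (X0 n) \<pi> Y) (rdpg_posterior.far n (X0 n) M\<^sub>1)" for n Y
  define dev where "dev n Y =
    (\<Sum>i<n. \<Sum>j<n. (posterior_mean n (X0 n) \<pi> Y i j - X0 n i \<bullet> X0 n j)\<^sup>2)" for n Y
  have dev: "dev n Y \<le> M\<^sub>1\<^sup>2 * real n + (real n)\<^sup>2 * p n Y" if "0 < n" for n Y
    unfolding dev_def p_def
    using rdpg_posterior.posterior_mean_error[OF post that, of M\<^sub>1 Y] M1_pos by simp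
  have p_nonneg: "0 \<le> p n Y" for n Y by (simp add: p_def)
  have integrable: "integrable (measure_pmf (rdpg n (X0 n))) f" for n and f :: "_ \<Rightarrow> real"
    by (rule integrable_measure_pmf_finite[OF finite_set_pmf_rdpg])
  have p_mean: "\<forall>\<^sub>F n in sequentially.
      measure_pmf.expectation (rdpg n (X0 n)) (p n) \<le> 8 * exp (- (1 / 2) * real n * real CARD('d))"
    using contraction unfolding p_def rdpg_posterior.far_def[OF post] by simp
  have gram: "\<forall>\<^sub>F n in sequentially. \<forall>v. (c * real n) * (v \<bullet> v) \<le> (\<Sum>i<n. (X0 n i \<bullet> v)\<^sup>2)"
    by (rule gram_limit_lower_bound[OF Delta_limit Delta_pd c(2)])
  have perturb: "spectral_perturbation n (X0 n) (U0 n) e (posterior_mean n (X0 n) \<pi> Y) (lam n Y) (u n Y) (c * real n)"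
    if "CARD('d) \<le> n" "0 < n" "\<forall>v. (c * real n) * (v \<bullet> v) \<le> (\<Sum>i<n. (X0 n i \<bullet> v)\<^sup>2)"
      "Y \<in> set_pmf (rdpg n (X0 n))" for n Y
  proof (rule spectral_perturbation.intro[OF that(1) e_bij spectral[OF that(4)]])
    show "0 \<le> lam n Y k" if "k < n" for k
      by (rule rdpg_posterior.posterior_mean_eigenvalue_nonneg[OF post spectral[OF \<open>Y \<in> _\<close>] that])
    show "0 < c * real n" using c(1) \<open>0 < n\<close> by simp
  qed (use that(3) U0_svd[OF that(1)] in blast)+
  have "\<forall>\<^sub>F n in sequentially. measure_pmf.expectation (rdpg n (X0 n))
      (\<lambda>Y. 1 / real n * procrustes_sq n (spectral_embedding e (lam n Y) (u n Y)) (X0 n))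
      \<le> (5 / c * (M\<^sub>1\<^sup>2 + 16)) / real n"
    using gram p_mean eventually_ge_at_top[of "CARD('d)"] eventually_gt_at_top[of 0]
  proof eventually_elim
    case (elim n)
    have "measure_pmf.expectation (rdpg n (X0 n))
        (\<lambda>Y. 1 / real n * procrustes_sq n (spectral_embedding e (lam n Y) (u n Y)) (X0 n))
      \<le> measure_pmf.expectation (rdpg n (X0 n)) (\<lambda>Y. 5 / c / real n * (M\<^sub>1\<^sup>2 + real n * p n Y))"
    proof (rule integral_mono_AE[OF integrable integrable], unfold AE_measure_pmf_iff, rule ballI)
      fix Y assume Y: "Y \<in> set_pmf (rdpg n (X0 n))"
      interpret spectral_perturbation n "X0 n" "U0 n" e "posterior_mean n (X0 n) \<pi> Y" "lam n Y" "u n Y" "c * real n"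
        by (rule perturb[OF elim(3,4,1) Y])
      have "procrustes_sq n (spectral_embedding e (lam n Y) (u n Y)) (X0 n) \<le> 5 / (c * real n) * dev n Y"
        using embedding_procrustes by (simp add: dev_def err_def)
      also have "\<dots> \<le> 5 / (c * real n) * (M\<^sub>1\<^sup>2 * real n + (real n)\<^sup>2 * p n Y)"
        using c(1) by (intro mult_left_mono dev elim) simp
      also have "\<dots> = real n * (5 / c / real n * (M\<^sub>1\<^sup>2 + real n * p n Y))"
        using elim c(1) by (simp add: field_simps power2_eq_square)
      finally show "1 / real n * procrustes_sq n (spectral_embedding e (lam n Y) (u n Y)) (X0 n)
          \<le> 5 / c / real n * (M\<^sub>1\<^sup>2 + real n * p n Y)"
        using elim by (simp add: field_simps)
    qed
    also have "\<dots> = 5 / c / real n * (M\<^sub>1\<^sup>2 + real n * measure_pmf.expectation (rdpg n (X0 n)) (p n))"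
      using integrable[of n "p n"] by simp
    also have "\<dots> \<le> 5 / c / real n * (M\<^sub>1\<^sup>2 + 16)"
    \<comment> \<open>The exponentially small far mass absorbs the factor n by which it is weighted.\<close>
    proof (intro mult_left_mono add_left_mono)
      have "real n / 2 \<le> exp (real n / 2)"
        using exp_ge_add_one_self[of "real n / 2"] by linarith
      then have half: "real n * exp (- (real n / 2)) \<le> 2"
        by (simp add: exp_minus field_simps)
      have "1 \<le> real CARD('d)" by (simp add: Suc_leI)
      then have "real n / 2 * 1 \<le> real n / 2 * real CARD('d)" by (intro mult_left_mono) auto
      then have "exp (- (1 / 2) * real n * real CARD('d)) \<le> exp (- (real n / 2))" by simp
      with elim(2) have "measure_pmf.expectation (rdpg n (X0 n)) (p n) \<le> 8 * exp (- (real n / 2))"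
        by linarith
      then have "real n * measure_pmf.expectation (rdpg n (X0 n)) (p n) \<le> real n * (8 * exp (- (real n / 2)))"
        by (intro mult_left_mono) auto
      also have "\<dots> \<le> 16" using half by simp
      finally show "real n * measure_pmf.expectation (rdpg n (X0 n)) (p n) \<le> 16" .
    qed (use c(1) in simp)
    finally show ?case by simp
  qed
  moreover have "0 < 5 / c * (M\<^sub>1\<^sup>2 + 16)" using c(1) by (intro mult_pos_pos add_nonneg_pos) auto
  moreover have "\<forall>\<^sub>F n in sequentially. measure_pmf.prob (rdpg n (X0 n))
      {Y. procrustes_sq n (leading_eigenvectors e (u n Y)) (U0 n)
          > 128 * M\<^sub>1\<^sup>2 * real CARD('d) / ((smallest_eigenvalue \<Delta>)\<^sup>2 * real n)}
      \<le> 2 * exp (- (1 / 4) * M\<^sub>1 * real CARD('d) * sqrt (real n))"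
    using gram p_mean eventually_ge_at_top[of "CARD('d)"] eventually_gt_at_top[of 0]
      tail_bound_eventually[OF M1_pos, of "real CARD('d)", simplified]
  proof eventually_elim
    case (elim n)
    let ?bad = "{Y. procrustes_sq n (leading_eigenvectors e (u n Y)) (U0 n)
          > 128 * M\<^sub>1\<^sup>2 * real CARD('d) / (\<mu>\<^sup>2 * real n)}"
    have n: "0 < real n" using elim by simp
    \<comment> \<open>With far mass below this level the squared error is at most 4 M1^2 n, and the resulting
      constant 10 * 4 * 16 / 9 is below 128.\<close>
    have large: "3 * M\<^sub>1\<^sup>2 / real n \<le> p n Y" if Y: "Y \<in> set_pmf (rdpg n (X0 n))" and bad: "Y \<in> ?bad" for Y
    proof (rule ccontr)
      assume "\<not> ?thesis"
      then have "(real n)\<^sup>2 * p n Y \<le> (real n)\<^sup>2 * (3 * M\<^sub>1\<^sup>2 / real n)"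
        by (intro mult_left_mono) auto
      also have "\<dots> = 3 * M\<^sub>1\<^sup>2 * real n" using n by (simp add: power2_eq_square)
      finally have small: "dev n Y \<le> 4 * M\<^sub>1\<^sup>2 * real n"
        using dev[of n Y] elim by simp
      interpret spectral_perturbation n "X0 n" "U0 n" e "posterior_mean n (X0 n) \<pi> Y" "lam n Y" "u n Y" "c * real n"
        by (rule perturb[OF elim(3,4,1) Y])
      have "procrustes_sq n (leading_eigenvectors e (u n Y)) (U0 n) \<le> 10 / (c * real n)\<^sup>2 * dev n Y"
        using eigenvectors_procrustes by (simp add: dev_def err_def)
      also have "\<dots> \<le> 10 / (c * real n)\<^sup>2 * (4 * M\<^sub>1\<^sup>2 * real n)"
        by (intro mult_left_mono small) simp
      also have "\<dots> = (640 / 9) * M\<^sub>1\<^sup>2 / (\<mu>\<^sup>2 * real n)"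
        using n mu by (simp add: c_def field_simps power2_eq_square)
      also have "\<dots> \<le> 128 * M\<^sub>1\<^sup>2 * real CARD('d) / (\<mu>\<^sup>2 * real n)"
      proof (intro divide_right_mono)
        have "1 \<le> real CARD('d)" by (simp add: Suc_leI)
        then have "M\<^sub>1\<^sup>2 * 1 \<le> M\<^sub>1\<^sup>2 * real CARD('d)" by (intro mult_left_mono) auto
        then show "640 / 9 * M\<^sub>1\<^sup>2 \<le> 128 * M\<^sub>1\<^sup>2 * real CARD('d)"
          using zero_le_power2[of M\<^sub>1] by linarith
      qed (use n in simp)
      finally show False using bad by simp
    qed
    have "measure_pmf.prob (rdpg n (X0 n)) ?bad \<le>
        measure_pmf.prob (rdpg n (X0 n)) {Y \<in> space (measure_pmf (rdpg n (X0 n))). 3 * M\<^sub>1\<^sup>2 / real n \<le> p n Y}"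
      using large by (intro measure_pmf.finite_measure_mono_AE) (auto simp: AE_measure_pmf_iff)
    also have "\<dots> \<le> measure_pmf.expectation (rdpg n (X0 n)) (p n) / (3 * M\<^sub>1\<^sup>2 / real n)"
      using n M1_pos p_nonneg by (intro integral_Markov_inequality_measure[where A = "{}"] integrable) auto
    also have "\<dots> \<le> (8 * exp (- (1 / 2) * real n * real CARD('d))) / (3 * M\<^sub>1\<^sup>2 / real n)"
      using n by (intro divide_right_mono elim(2)) simp
    also have "\<dots> = real n / (3 * M\<^sub>1\<^sup>2) * (8 * exp (- (1 / 2) * real n * real CARD('d)))"
      by simp
    also have "\<dots> \<le> 2 * exp (- (1 / 4) * M\<^sub>1 * real CARD('d) * sqrt (real n))"
      using elim(5) by simp
    finally show ?case by (simp only: \<mu>_def)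
  qed
  ultimately show ?thesis by blast
qed

end
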